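(* Consider the single-source heterogeneous network (described in the context) with $n=2$ servers, arrival rates $\lambda_1,\lambda_2>0$ and service rates $\mu_1,\mu_2>0$. The average age of information at the monitor is $$\Delta=\frac{1}{\mu_1+\mu_2}+\frac{1}{\lambda_1+\lambda_2}+\frac{1}{(\mu_1+\mu_2)(\lambda_1+\lambda_2)}\left(\frac{\mu_1\lambda_2}{\lambda_1+\mu_2}+\frac{\mu_2\lambda_1}{\lambda_2+\mu_1}\right).$$
   Context: Network model: one information source, $n$ servers and a monitor. Updates arrive at server $j$ according to a Poisson process of rate $\lambda_j>0$, independent across servers; an update's generation time is its arrival time. Server $j$ transmits to the monitor with i.i.d. exponential service times of rate $\mu_j>0$. Each server uses LCFS with preemption in service: a new arrival immediately replaces the update in service; on service completion the update is delivered to the monitor and the server is idle until the next arrival. With $u(t)$ the largest generation time among updates delivered by time $t$, the age is $\Delta(t)=t-u(t)$ and the average age is $\Delta=\lim_{T\to\infty}\frac1T\int_0^T\Delta(t)dt$. *)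

theory Defs
  imports "HOL-Probability.Probability"
begin

text \<open>Sample-path model.  Server j (j < n) receives its k-th update (k = 0,1,2,...)
  at time arr X j k = X j 0 + ... + X j k, where the X j i are the i.i.d. exponential
  interarrival times.  Update (j,k) has its own service time S j k.  Under LCFS with
  preemption in service every arriving update immediately enters service, and it is
  delivered at time arr X j k + S j k iff it completes before the next arrival at
  server j, i.e. iff S j k < X j (k+1).\<close>

definition arr :: "(nat \<Rightarrow> nat \<Rightarrow> real) \<Rightarrow> nat \<Rightarrow> nat \<Rightarrow> real" where
  "arr X j k = (\<Sum>i\<le>k. X j i)"

definition delivered :: "(nat \<Rightarrow> nat \<Rightarrow> real) \<Rightarrow> (nat \<Rightarrow> nat \<Rightarrow> real) \<Rightarrow> nat \<Rightarrow> nat \<Rightarrow> bool" where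
  "delivered X S j k \<longleftrightarrow> S j k < X j (Suc k)"

definition latest_gen :: "nat \<Rightarrow> (nat \<Rightarrow> nat \<Rightarrow> real) \<Rightarrow> (nat \<Rightarrow> nat \<Rightarrow> real) \<Rightarrow> real \<Rightarrow> real" where
  "latest_gen n X S t = Sup (insert 0 {arr X j k | j k. j < n \<and> delivered X S j k \<and> arr X j k + S j k \<le> t})"

definition age :: "nat \<Rightarrow> (nat \<Rightarrow> nat \<Rightarrow> real) \<Rightarrow> (nat \<Rightarrow> nat \<Rightarrow> real) \<Rightarrow> real \<Rightarrow> real" where
  "age n X S t = t - latest_gen n X S t"

end

theory Submission
  imports Defs "HOL-Real_Asymp.Real_Asymp"
begin

text \<open>The age at time \<open>t\<close> is the length of the set of \<open>a \<in> [0, t]\<close> such that no update generated in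
  \<open>[a, t]\<close> has been delivered by \<open>t\<close>, so the time integral of the age over \<open>[0, T]\<close> is the area of a
  random subset of the wedge \<open>0 \<le> a \<le> t \<le> T\<close>. The event attached to \<open>(a, t)\<close> is the intersection of
  the corresponding events of the two independent servers. For one server, renewal at the first
  arrival and memorylessness show that this event has a probability depending only on \<open>t - a\<close>,
  namely the tail of a sum of independent exponential variables of rates \<open>\<lambda>\<close> and \<open>\<mu>\<close>, and that the
  events of disjoint intervals are independent. Hence the area has mean \<open>c T + O(1)\<close>, where \<open>c\<close> is the
  integral of the product of the two tails, and variance \<open>O(T)\<close>. Summing second moments along
  \<open>T = n\<^sup>2\<close> gives almost sure convergence along squares, and monotonicity in \<open>T\<close> fills the gaps.\<close>

section \<open>Exponential laws and packet sequences\<close>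

text \<open>The tail of a sum of two exponential variables arises because preemption does not
  disturb the delivery process: once the first update generated from time \<open>a\<close> on has
  arrived, the server stays busy until a delivery, and replacing the update in service by a newer
  one leaves the residual service time exponential of the same rate. The wait is therefore one
  interarrival time followed by one service time. Memorylessness is used at times preceded by a
  random number of packets. Instead of a strong Markov property, both sides of each identity are
  shown to solve the same renewal equation in the first interarrival time, whose bounded solution is
  unique. The empty start at time 0 causes no transient in the probabilities, since the events
  ignore every update generated before \<open>a\<close>; the \<open>O(1)\<close> in the mean comes
  only from truncating the ages at the elapsed time. Independence over disjoint intervals is exact,
  so only overlapping pairs contribute to the variance, and for these the exponential tails
  suffice.\<close>

lemma borel_measurable_of_bool [measurable (raw)]:
  assumes [measurable]: "Measurable.pred M P"
  shows "(\<lambda>x. of_bool (P x) :: 'b :: {topological_space, zero_neq_one}) \<in> borel_measurable M"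
  unfolding of_bool_def by measurable

lemma (in prob_space) integral_in_unit_interval:
  fixes f :: "'a \<Rightarrow> real"
  assumes [measurable]: "f \<in> borel_measurable M" and "\<And>x. 0 \<le> f x" "\<And>x. f x \<le> 1"
  shows "0 \<le> (\<integral>x. f x \<partial>M)" "(\<integral>x. f x \<partial>M) \<le> 1"
proof -
  show "0 \<le> (\<integral>x. f x \<partial>M)" using assms by simp
  have "(\<integral>x. f x \<partial>M) \<le> (\<integral>x. 1 \<partial>M)"
    using assms by (intro integral_mono integrable_const_bound[where B = 1]) auto
  then show "(\<integral>x. f x \<partial>M) \<le> 1" by (simp add: prob_space)
qed

definition exp_law :: "real \<Rightarrow> real measure" where
  "exp_law l = density lborel (exponential_density l)"

lemma sets_exp_law [simp, measurable_cong]: "sets (exp_law l) = sets borel"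
  by (simp add: exp_law_def)

lemma space_exp_law [simp]: "space (exp_law l) = UNIV"
  by (simp add: exp_law_def)

lemma prob_space_exp_law: "0 < l \<Longrightarrow> prob_space (exp_law l)"
  unfolding exp_law_def by (rule prob_space_exponential_density)

lemma AE_exp_law_nonneg: "AE x in exp_law l. 0 \<le> x"
  unfolding exp_law_def by (subst AE_density) (auto simp: exponential_density_def)

lemma AE_exp_law_neq: "AE x in exp_law l. x \<noteq> c"
  unfolding exp_law_def by (subst AE_density) (auto intro: AE_mp[OF AE_lborel_singleton[of c]])

lemma integral_exp_law:
  fixes f :: "real \<Rightarrow> real"
  assumes "0 < l" "f \<in> borel_measurable borel"
  shows "(\<integral>x. f x \<partial>exp_law l) = (\<integral>x. exponential_density l x * f x \<partial>lborel)"
  unfolding exp_law_def using assms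
  by (subst integral_density) (auto simp: exponential_density_nonneg)

text \<open>Stated for a function of the overshoot \<open>x - a\<close>, because the packets after
  time \<open>a\<close> are later regarded as a fresh sequence whose first interarrival time is this
  overshoot.\<close>

lemma exp_law_memoryless:
  fixes k :: "real \<Rightarrow> real"
  assumes "0 < l" "0 \<le> a" and [measurable]: "k \<in> borel_measurable borel"
  shows "(\<integral>x. (if x < a then 0 else k (x - a)) \<partial>exp_law l) = exp (- l * a) * (\<integral>x. k x \<partial>exp_law l)"
proof -
  have "(\<integral>x. (if x < a then 0 else k (x - a)) \<partial>exp_law l)
      = (\<integral>x. exponential_density l x * (if x < a then 0 else k (x - a)) \<partial>lborel)"
    using assms(1) by (intro integral_exp_law) auto
  also have "\<dots> = (\<integral>x. exponential_density l (a + x) * (if a + x < a then 0 else k (a + x - a)) \<partial>lborel)"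
    by (subst lborel_integral_real_affine[where c = 1 and t = a]) (simp_all cong: if_cong)
  also have "\<dots> = (\<integral>x. exp (- l * a) * (exponential_density l x * k x) \<partial>lborel)"
    using assms(2) by (intro Bochner_Integration.integral_cong refl)
      (auto simp: exponential_density_def exp_add[symmetric] algebra_simps)
  also have "\<dots> = exp (- l * a) * (\<integral>x. k x \<partial>exp_law l)"
    using assms(1) by (simp add: integral_exp_law)
  finally show ?thesis .
qed

lemma integral_exp_law_tail:
  assumes "0 < l" "0 \<le> a"
  shows "(\<integral>x. (if x < a then 0 else 1) \<partial>exp_law l) = exp (- l * a)"
  using exp_law_memoryless[OF assms, of "\<lambda>_. 1"] prob_space.prob_space[OF prob_space_exp_law[OF assms(1)]]
  by simp

lemma integral_exp_law_head:
  assumes "0 < l" "0 \<le> a"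
  shows "(\<integral>x. (if x < a then 1 else 0) \<partial>exp_law l) = 1 - exp (- l * a)"
proof -
  interpret prob_space "exp_law l" by (rule prob_space_exp_law) fact
  have "(\<integral>x. (if x < a then 1 else (0::real)) \<partial>exp_law l) = (\<integral>x. 1 - (if x < a then 0 else 1) \<partial>exp_law l)"
    by (intro Bochner_Integration.integral_cong) auto
  also have "\<dots> = (\<integral>x. 1 \<partial>exp_law l) - (\<integral>x. (if x < a then 0 else 1) \<partial>exp_law l)"
    by (intro Bochner_Integration.integral_diff integrable_const_bound[where B = 1]) auto
  also have "\<dots> = 1 - exp (- l * a)"
    using integral_exp_law_tail[OF assms] prob_space by simp
  finally show ?thesis .
qed

lemma integral_exp_law_head_bound:
  fixes h :: "real \<Rightarrow> real"
  assumes "0 < l" "0 \<le> a" "\<And>x. 0 \<le> x \<Longrightarrow> x < a \<Longrightarrow> \<bar>h x\<bar> \<le> c" "0 \<le> c"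
  shows "\<bar>\<integral>x. (if x < a then h x else 0) \<partial>exp_law l\<bar> \<le> (1 - exp (- l * a)) * c"
proof -
  interpret prob_space "exp_law l" by (rule prob_space_exp_law) fact
  have "\<bar>\<integral>x. (if x < a then h x else 0) \<partial>exp_law l\<bar> \<le> (\<integral>x. (if x < a then 1 else 0) * c \<partial>exp_law l)"
  proof (cases "integrable (exp_law l) (\<lambda>x. if x < a then h x else 0)")
    case True
    have "\<bar>\<integral>x. (if x < a then h x else 0) \<partial>exp_law l\<bar> \<le> (\<integral>x. \<bar>if x < a then h x else 0\<bar> \<partial>exp_law l)"
      by (rule integral_abs_bound)
    also have "\<dots> \<le> (\<integral>x. (if x < a then 1 else 0) * c \<partial>exp_law l)"
    proof (rule integral_mono_AE)
      show "AE x in exp_law l. \<bar>if x < a then h x else 0\<bar> \<le> (if x < a then 1 else 0) * c"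
        by (rule AE_mp[OF AE_exp_law_nonneg]) (use assms in auto)
      show "integrable (exp_law l) (\<lambda>x. (if x < a then 1 else 0) * c)"
        by (intro integrable_const_bound[where B = "\<bar>c\<bar>"]) auto
    qed (use True in auto)
    finally show ?thesis .
  next
    \<comment> \<open>A nonintegrable integrand has Bochner integral 0 by convention, so the bound
      persists; \<open>renewal_unique\<close> applies it to integrands \<open>h\<close> about which
      only a pointwise bound is known.\<close>
    case False
    then have "(\<integral>x. (if x < a then h x else 0) \<partial>exp_law l) = 0"
      by (rule not_integrable_integral_eq)
    then show ?thesis using assms(4) by (auto intro!: integral_nonneg_AE)
  qed
  also have "\<dots> = (1 - exp (- l * a)) * c"
    using integral_exp_law_head[OF assms(1,2)] by simp
  finally show ?thesis .
qed

text \<open>A sequence \<open>z\<close> describes one server: \<open>z k\<close> is the pair of the \<open>k\<close>-th interarrival time and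
  the service time of the \<open>k\<close>-th update.\<close>

definition gen_time :: "(nat \<Rightarrow> real \<times> real) \<Rightarrow> nat \<Rightarrow> real" where
  "gen_time z k = (\<Sum>i\<le>k. fst (z i))"

text \<open>No update generated at or after time \<open>a\<close> has been delivered by time \<open>t\<close>; up to a null set of
  times \<open>a\<close> this says that the server's age at time \<open>t\<close> exceeds \<open>t - a\<close>.\<close>

definition quiet :: "(nat \<Rightarrow> real \<times> real) \<Rightarrow> real \<Rightarrow> real \<Rightarrow> bool" where
  "quiet z a t \<longleftrightarrow> (\<forall>k. snd (z k) < fst (z (Suc k)) \<and> gen_time z k + snd (z k) \<le> t \<longrightarrow> gen_time z k < a)"

definition nonneg_seq :: "(nat \<Rightarrow> real \<times> real) \<Rightarrow> bool" where
  "nonneg_seq z \<longleftrightarrow> (\<forall>k. 0 \<le> fst (z k) \<and> 0 \<le> snd (z k))"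

lemma gen_time_cons:
  "gen_time (case_nat p z) 0 = fst p" "gen_time (case_nat p z) (Suc k) = fst p + gen_time z k"
  unfolding gen_time_def by (simp_all add: sum.atMost_Suc_shift del: sum.atMost_Suc)

text \<open>The recursion behind all renewal arguments. The tail sequence starts its clock at the
  first arrival \<open>x\<close>, so both endpoints move by \<open>x\<close>; the fate of the first
  update involves the tail only through \<open>fst (z 0)\<close>, the wait for the arrival that
  would preempt it.\<close>

lemma quiet_cons:
  "quiet (case_nat (x, s) z) a t \<longleftrightarrow>
     (s < fst (z 0) \<and> x + s \<le> t \<longrightarrow> x < a) \<and> quiet z (a - x) (t - x)"
  proof -
  have split: "(\<forall>k. P k) \<longleftrightarrow> P 0 \<and> (\<forall>k. P (Suc k))" for P
    by (metis not0_implies_Suc)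
  show ?thesis
    unfolding quiet_def by (subst split) (auto simp: gen_time_cons algebra_simps)
qed

lemma gen_time_nonneg: "nonneg_seq z \<Longrightarrow> 0 \<le> gen_time z k"
  unfolding gen_time_def nonneg_seq_def by (auto intro: sum_nonneg)

lemma quiet_empty:
  assumes "nonneg_seq z" "t < a"
  shows "quiet z a t"
  unfolding quiet_def
proof safe
  fix k assume "gen_time z k + snd (z k) \<le> t"
  moreover have "0 \<le> snd (z k)" using assms by (auto simp: nonneg_seq_def)
  ultimately show "gen_time z k < a" using assms(2) by linarith
qed

lemma quiet_negative:
  assumes "nonneg_seq z" "t < 0"
  shows "quiet z a t"
  unfolding quiet_def
proof safe
  fix k assume "gen_time z k + snd (z k) \<le> t"
  moreover have "0 \<le> snd (z k)" using assms by (auto simp: nonneg_seq_def)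
  ultimately show "gen_time z k < a" using assms(2) gen_time_nonneg[OF assms(1), of k] by linarith
qed

text \<open>Subtracting an arrival time that lies beyond the left endpoint makes that endpoint
  negative; resetting it to 0 brings the recursion back to its original form.\<close>

lemma quiet_nonpos_left:
  assumes "nonneg_seq z" "a \<le> 0"
  shows "quiet z a t \<longleftrightarrow> quiet z 0 t"
proof -
  have "\<not> gen_time z k < a" "\<not> gen_time z k < 0" for k
    using gen_time_nonneg[OF assms(1), of k] assms(2) by auto
  then show ?thesis unfolding quiet_def by simp
qed

section \<open>The i.i.d. packet sequence of one server and its renewal at the first packet\<close>

locale server =
  fixes l m :: real
  assumes arrival_rate_pos: "0 < l" and service_rate_pos: "0 < m"
begin

definition law :: "(nat \<Rightarrow> real \<times> real) measure" where
  "law = PiM UNIV (\<lambda>_. exp_law l \<Otimes>\<^sub>M exp_law m)"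

sublocale arrival: prob_space "exp_law l"
  by (rule prob_space_exp_law) (rule arrival_rate_pos)

sublocale service: prob_space "exp_law m"
  by (rule prob_space_exp_law) (rule service_rate_pos)

sublocale mark: pair_prob_space "exp_law l" "exp_law m" ..

sublocale packets: sequence_space "exp_law l \<Otimes>\<^sub>M exp_law m" ..

sublocale law: prob_space law
  unfolding law_def by (rule packets.prob_space_axioms)

lemma space_law [simp]: "space law = UNIV"
  by (simp add: law_def space_PiM space_pair_measure)

lemma sets_law [measurable_cong]: "sets law = sets (PiM UNIV (\<lambda>_. borel \<Otimes>\<^sub>M borel))"
  unfolding law_def by (intro sets_PiM_cong refl sets_pair_measure_cong) simp_all

text \<open>Joint measurability in the sequence and both endpoints, since the endpoints are later
  integrated, first over arrival times and then over the wedge.\<close>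

lemma measurable_quiet [measurable (raw)]:
  assumes [measurable]: "f \<in> measurable N law" "g \<in> borel_measurable N" "h \<in> borel_measurable N"
  shows "Measurable.pred N (\<lambda>w. quiet (f w) (g w) (h w))"
proof -
  have [measurable]: "(\<lambda>w. f w k) \<in> measurable N (borel \<Otimes>\<^sub>M borel)" for k
  proof -
    have "(\<lambda>z. z k) \<in> measurable law (borel \<Otimes>\<^sub>M borel)"
      by measurable
    from measurable_compose[OF assms(1) this] show ?thesis .
  qed
  show ?thesis unfolding quiet_def gen_time_def by measurable
qed

lemma AE_nonneg_seq: "AE z in law. nonneg_seq z"
proof -
  have *: "AE p in exp_law l \<Otimes>\<^sub>M exp_law m. 0 \<le> fst p \<and> 0 \<le> snd p"
  proof (rule mark.AE_pair_measure)
    show "{x \<in> space (exp_law l \<Otimes>\<^sub>M exp_law m). 0 \<le> fst x \<and> 0 \<le> snd x} \<in> sets (exp_law l \<Otimes>\<^sub>M exp_law m)"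
      by measurable
    show "AE x in exp_law l. AE y in exp_law m. 0 \<le> fst (x, y) \<and> 0 \<le> snd (x, y)"
      using AE_exp_law_nonneg[of l] by eventually_elim (use AE_exp_law_nonneg[of m] in simp)
  qed
  have "AE z in law. 0 \<le> fst (z k) \<and> 0 \<le> snd (z k)" for k
    unfolding law_def using * by (intro AE_PiM_component packets.prob_space) (auto intro: mark.P.prob_space_axioms)
  then show ?thesis
    unfolding nonneg_seq_def by (simp add: AE_all_countable)
qed

lemma measurable_cons [measurable]:
  "(\<lambda>(p, z). case_nat p z) \<in> measurable ((exp_law l \<Otimes>\<^sub>M exp_law m) \<Otimes>\<^sub>M law) law"
  unfolding law_def by measurable

text \<open>An i.i.d. sequence has the law of one fresh packet put in front of an independent copy
  of the sequence; Fubini then separates the packet into its interarrival time \<open>x\<close> and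
  service time \<open>s\<close>. The bound \<open>B\<close> supplies integrability.\<close>

lemma renewal:
  fixes f :: "(nat \<Rightarrow> real \<times> real) \<Rightarrow> real"
  assumes [measurable]: "f \<in> borel_measurable law" and bd: "\<And>z. \<bar>f z\<bar> \<le> B"
  shows "(\<integral>z. f z \<partial>law) = (\<integral>x. (\<integral>s. (\<integral>z. f (case_nat (x, s) z) \<partial>law) \<partial>exp_law m) \<partial>exp_law l)"
proof -
  interpret pl: pair_prob_space "exp_law l \<Otimes>\<^sub>M exp_law m" law ..
  have [measurable]: "(\<lambda>(p, z). f (case_nat p z)) \<in> borel_measurable ((exp_law l \<Otimes>\<^sub>M exp_law m) \<Otimes>\<^sub>M law)"
    using measurable_compose[OF measurable_cons assms(1)] by (simp add: case_prod_unfold)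
  have "(\<integral>z. f z \<partial>law) = (\<integral>z. f z \<partial>distr ((exp_law l \<Otimes>\<^sub>M exp_law m) \<Otimes>\<^sub>M law) law (\<lambda>(s, \<omega>). case_nat s \<omega>))"
    unfolding law_def by (subst packets.PiM_iter) simp
  also have "\<dots> = (\<integral>p. f (case p of (s, \<omega>) \<Rightarrow> case_nat s \<omega>) \<partial>((exp_law l \<Otimes>\<^sub>M exp_law m) \<Otimes>\<^sub>M law))"
    using measurable_cons by (intro integral_distr) (simp_all add: case_prod_unfold)
  also have "\<dots> = (\<integral>p. (\<integral>z. f (case_nat p z) \<partial>law) \<partial>(exp_law l \<Otimes>\<^sub>M exp_law m))"
    by (subst pl.integral_fst'[symmetric])
       (auto intro!: pl.P.integrable_const_bound[where B = B] bd simp: case_prod_unfold)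
  also have "\<dots> = (\<integral>x. (\<integral>s. (\<integral>z. f (case_nat (x, s) z) \<partial>law) \<partial>exp_law m) \<partial>exp_law l)"
  proof (subst mark.integral_fst'[symmetric])
    have "\<bar>\<integral>z. f (case_nat p z) \<partial>law\<bar> \<le> B" for p
    proof (cases "integrable law (\<lambda>z. f (case_nat p z))")
      case True
      then have "\<bar>\<integral>z. f (case_nat p z) \<partial>law\<bar> \<le> (\<integral>z. \<bar>f (case_nat p z)\<bar> \<partial>law)"
        by (intro integral_abs_bound)
      also have "\<dots> \<le> (\<integral>z. B \<partial>law)"
        using True bd by (intro integral_mono) auto
      finally show ?thesis using law.prob_space by simp
    next
      case False
      then have "(\<integral>z. f (case_nat p z) \<partial>law) = 0" by (rule not_integrable_integral_eq)
      then show ?thesis using bd[of undefined] by simp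
    qed
    then show "integrable (exp_law l \<Otimes>\<^sub>M exp_law m) (\<lambda>p. \<integral>z. f (case_nat p z) \<partial>law)"
      by (intro mark.P.integrable_const_bound[where B = B]) (auto simp: case_prod_unfold)
  qed simp
  finally show ?thesis .
qed

end

section \<open>Renewal analysis of one server\<close>

text \<open>The common shape of the renewal equations: an arrival before \<open>a\<close> enters
  through its actual time, a later one only through its overshoot, so memorylessness collapses the
  second part to a constant.\<close>

lemma integral_exp_law_split:
  fixes h k :: "real \<Rightarrow> real"
  assumes "0 < l" "0 \<le> a"
    and [measurable]: "h \<in> borel_measurable borel" "k \<in> borel_measurable borel"
    and h: "\<And>x. \<bar>h x\<bar> \<le> B" and k: "\<And>x. \<bar>k x\<bar> \<le> B"
  shows "(\<integral>x. (if x < a then h x else k (x - a)) \<partial>exp_law l)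
    = (\<integral>x. (if x < a then h x else 0) \<partial>exp_law l) + exp (- l * a) * (\<integral>x. k x \<partial>exp_law l)"
proof -
  interpret prob_space "exp_law l" by (rule prob_space_exp_law) fact
  have B: "0 \<le> B" using h[of 0] by linarith
  have "(\<integral>x. (if x < a then h x else k (x - a)) \<partial>exp_law l)
      = (\<integral>x. (if x < a then h x else 0) + (if x < a then 0 else k (x - a)) \<partial>exp_law l)"
    by (intro Bochner_Integration.integral_cong) auto
  also have "\<dots> = (\<integral>x. (if x < a then h x else 0) \<partial>exp_law l) + (\<integral>x. (if x < a then 0 else k (x - a)) \<partial>exp_law l)"
    using h k B by (intro Bochner_Integration.integral_add integrable_const_bound[where B = B]) auto
  also have "(\<integral>x. (if x < a then 0 else k (x - a)) \<partial>exp_law l) = exp (- l * a) * (\<integral>x. k x \<partial>exp_law l)"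
    by (rule exp_law_memoryless) (use assms in auto)
  finally show ?thesis .
qed

text \<open>On \<open>r \<le> R\<close> the renewal operator contracts by the factor \<open>1 - exp (- l * R)\<close>, the probability
  of an arrival before \<open>R\<close>.\<close>

lemma renewal_unique:
  fixes d :: "real \<Rightarrow> 'p \<Rightarrow> real"
  assumes l: "0 < l"
    and bound: "\<And>r p. 0 \<le> r \<Longrightarrow> ok r p \<Longrightarrow> \<bar>d r p\<bar> \<le> 1"
    and step: "\<And>r p. 0 \<le> r \<Longrightarrow> ok r p \<Longrightarrow> \<exists>h. d r p = (\<integral>x. (if x < r then h x else 0) \<partial>exp_law l) \<and>
      (\<forall>x. 0 \<le> x \<longrightarrow> x < r \<longrightarrow> (\<exists>p'. ok (r - x) p' \<and> \<bar>h x\<bar> \<le> \<bar>d (r - x) p'\<bar>))"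
    and "0 \<le> R" "ok R p"
  shows "d R p = 0"
proof -
  define q where "q = 1 - exp (- l * R)"
  have q: "0 \<le> q" "q < 1" using l \<open>0 \<le> R\<close> by (auto simp: q_def)
  \<comment> \<open>The bound is uniform over all \<open>r \<le> R\<close> and all admissible
    parameters because one step changes both: the horizon shrinks to \<open>r - x\<close> and
    \<open>p\<close> is replaced by some \<open>p'\<close>.\<close>
  have pow: "\<bar>d r p\<bar> \<le> q ^ n" if "0 \<le> r" "r \<le> R" "ok r p" for n r p
    using that
  proof (induction n arbitrary: r p)
    case 0 then show ?case using bound by simp
  next
    case (Suc n)
    obtain h where h: "d r p = (\<integral>x. (if x < r then h x else 0) \<partial>exp_law l)"
      "\<And>x. 0 \<le> x \<Longrightarrow> x < r \<Longrightarrow> \<exists>p'. ok (r - x) p' \<and> \<bar>h x\<bar> \<le> \<bar>d (r - x) p'\<bar>"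
      using step[OF Suc.prems(1,3)] by auto
    have "\<bar>h x\<bar> \<le> q ^ n" if x: "0 \<le> x" "x < r" for x
    proof -
      obtain p' where p': "ok (r - x) p'" "\<bar>h x\<bar> \<le> \<bar>d (r - x) p'\<bar>" using h(2)[OF x] by auto
      then have "\<bar>d (r - x) p'\<bar> \<le> q ^ n" using Suc.prems x by (intro Suc.IH) auto
      with p' show ?thesis by linarith
    qed
    then have "\<bar>d r p\<bar> \<le> (1 - exp (- l * r)) * q ^ n"
      unfolding h(1) using l Suc.prems q by (intro integral_exp_law_head_bound) auto
    also have "\<dots> \<le> q * q ^ n"
      using Suc.prems l q by (intro mult_right_mono) (auto simp: q_def)
    finally show ?case by simp
  qed
  have "(\<lambda>n. q ^ n) \<longlonglongrightarrow> 0" using q by (intro LIMSEQ_realpow_zero) auto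
  then have "\<bar>d R p\<bar> \<le> 0"
    by (rule LIMSEQ_le_const) (use pow[of R p] assms(4,5) in auto)
  then show ?thesis by simp
qed

context server
begin

lemma measurable_case_nat_law [measurable (raw)]:
  assumes [measurable]: "f \<in> measurable N (borel \<Otimes>\<^sub>M borel)" "g \<in> measurable N law"
  shows "(\<lambda>w. case_nat (f w) (g w)) \<in> measurable N law"
proof -
  have [measurable]: "g \<in> measurable N (PiM UNIV (\<lambda>_. borel \<Otimes>\<^sub>M borel))"
    using assms(2) by (simp cong: measurable_cong_sets add: sets_law)
  have "(\<lambda>w. case_nat (f w) (g w)) \<in> measurable N (PiM UNIV (\<lambda>_. borel \<Otimes>\<^sub>M borel))"
    by measurable
  then show ?thesis by (simp cong: measurable_cong_sets add: sets_law)
qed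

lemma measure_law_UNIV [simp]: "measure law UNIV = 1"
  using law.prob_space by simp

lemma measurable_law_fst_0 [measurable]: "(\<lambda>z. fst (z 0)) \<in> borel_measurable law"
  by measurable

section \<open>Stationarity under time shifts\<close>

text \<open>The marked Poisson process looks the same from time \<open>a\<close> as from time 0.
  Hypotheses \<open>lt\<close> and \<open>ge\<close> express that \<open>P a\<close> concerns only
  what arrives from \<open>a\<close> on: an arrival before \<open>a\<close> can be discarded, and a
  later one counts through its overshoot, which is again exponential.\<close>

lemma shift_invariance:
  fixes P :: "real \<Rightarrow> (nat \<Rightarrow> real \<times> real) \<Rightarrow> bool"
  assumes meas: "Measurable.pred (borel \<Otimes>\<^sub>M law) (\<lambda>(a, z). P a z)"
    and lt: "\<And>a x s z. x < a \<Longrightarrow> P a (case_nat (x, s) z) \<longleftrightarrow> P (a - x) z"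
    and ge: "\<And>a x s z. a \<le> x \<Longrightarrow> P a (case_nat (x, s) z) \<longleftrightarrow> P 0 (case_nat (x - a, s) z)"
    and "0 \<le> a"
  shows "(\<integral>z. of_bool (P a z) \<partial>law) = (\<integral>z. of_bool (P 0 z) \<partial>law :: real)"
proof -
  have [measurable (raw)]: "Measurable.pred N (\<lambda>w. P (f w) (g w))"
    if [measurable]: "f \<in> borel_measurable N" "g \<in> measurable N law" for f g N
  proof -
    have "(\<lambda>w. (f w, g w)) \<in> measurable N (borel \<Otimes>\<^sub>M law)" by measurable
    from measurable_compose[OF this meas] show ?thesis by simp
  qed
  define F where "F a = (\<integral>z. of_bool (P a z) \<partial>law :: real)" for a
  define k where "k x = (\<integral>s. (\<integral>z. of_bool (P 0 (case_nat (x, s) z)) \<partial>law) \<partial>exp_law m :: real)" for x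
  have [measurable]: "F \<in> borel_measurable borel" unfolding F_def by measurable
  have [measurable]: "k \<in> borel_measurable borel" unfolding k_def by measurable
  have F01: "0 \<le> F a" "F a \<le> 1" for a
    unfolding F_def by (auto intro!: law.integral_in_unit_interval)
  have k01: "0 \<le> k a" "k a \<le> 1" for a
    unfolding k_def by (auto intro!: law.integral_in_unit_interval service.integral_in_unit_interval)
  have F0: "F 0 = (\<integral>x. k x \<partial>exp_law l)"
    unfolding F_def k_def by (subst renewal[where B = 1]) auto
  \<comment> \<open>The constant \<open>F 0\<close> solves the same renewal equation as
    \<open>F\<close>, so the difference solves the homogeneous one; nothing but the horizon varies,
    hence the trivial parameter type.\<close>
  have "F a - F 0 = 0"
  proof (rule renewal_unique[where d = "\<lambda>r (_::unit). F r - F 0" and ok = "\<lambda>_ _. True", OF arrival_rate_pos])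
    fix r :: real assume r: "0 \<le> r"
    show "\<bar>F r - F 0\<bar> \<le> 1" using F01[of r] F01[of 0] by linarith
    have "F r = (\<integral>x. (\<integral>s. (\<integral>z. of_bool (P r (case_nat (x, s) z)) \<partial>law) \<partial>exp_law m) \<partial>exp_law l)"
      unfolding F_def by (subst renewal[where B = 1]) auto
    also have "\<dots> = (\<integral>x. (if x < r then F (r - x) else k (x - r)) \<partial>exp_law l)"
    proof (intro Bochner_Integration.integral_cong refl)
      fix x
      show "(\<integral>s. (\<integral>z. of_bool (P r (case_nat (x, s) z)) \<partial>law) \<partial>exp_law m)
        = (if x < r then F (r - x) else k (x - r))"
      proof (cases "x < r")
        case True
        then show ?thesis using service.prob_space by (simp add: lt F_def)
      next
        case False
        then have "P r (case_nat (x, s) z) \<longleftrightarrow> P 0 (case_nat (x - r, s) z)" for s z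
          by (intro ge) simp
        with False show ?thesis by (simp add: k_def)
      qed
    qed
    also have "\<dots> = (\<integral>x. (if x < r then F (r - x) else 0) \<partial>exp_law l) + exp (- l * r) * F 0"
      unfolding F0 using F01 k01 r arrival_rate_pos
      by (intro integral_exp_law_split[where B = 1]) auto
    finally have 1: "F r = (\<integral>x. (if x < r then F (r - x) else 0) \<partial>exp_law l) + exp (- l * r) * F 0" .
    have "(\<integral>x. (if x < r then F (r - x) - F 0 else 0) \<partial>exp_law l)
        = (\<integral>x. (if x < r then F (r - x) else 0) - (if x < r then 1 else 0) * F 0 \<partial>exp_law l)"
      by (intro Bochner_Integration.integral_cong) auto
    also have "\<dots> = (\<integral>x. (if x < r then F (r - x) else 0) \<partial>exp_law l) - (\<integral>x. (if x < r then 1 else 0) * F 0 \<partial>exp_law l)"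
      using F01 by (intro Bochner_Integration.integral_diff arrival.integrable_const_bound[where B = 1]) auto
    also have "\<dots> = F r - F 0"
    proof -
      have "(\<integral>x. (if x < r then 1 else 0) * F 0 \<partial>exp_law l) = (1 - exp (- l * r)) * F 0"
        using integral_exp_law_head[OF arrival_rate_pos r] by simp
      with 1 show ?thesis by (simp add: left_diff_distrib)
    qed
    finally show "\<exists>h. F r - F 0 = (\<integral>x. (if x < r then h x else 0) \<partial>exp_law l) \<and>
      (\<forall>x. 0 \<le> x \<longrightarrow> x < r \<longrightarrow> (\<exists>p'. True \<and> \<bar>h x\<bar> \<le> \<bar>F (r - x) - F 0\<bar>))"
      by (intro exI[of _ "\<lambda>x. F (r - x) - F 0"]) auto
  qed (use \<open>0 \<le> a\<close> in auto)
  then show ?thesis by (simp add: F_def)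
qed

lemma quiet_pair_shift:
  assumes "0 \<le> a" "0 \<le> u" "0 \<le> u'"
  shows "(\<integral>z. of_bool (quiet z (a + u) (a + v) \<and> quiet z (a + u') (a + v')) \<partial>law)
    = (\<integral>z. of_bool (quiet z u v \<and> quiet z u' v') \<partial>law :: real)"
proof -
  have "(\<integral>z. of_bool (quiet z (a + u) (a + v) \<and> quiet z (a + u') (a + v')) \<partial>law)
    = (\<integral>z. of_bool (quiet z (0 + u) (0 + v) \<and> quiet z (0 + u') (0 + v')) \<partial>law :: real)"
  proof (rule shift_invariance[where P = "\<lambda>a z. quiet z (a + u) (a + v) \<and> quiet z (a + u') (a + v')"])
    show "Measurable.pred (borel \<Otimes>\<^sub>M law) (\<lambda>(a, z). quiet z (a + u) (a + v) \<and> quiet z (a + u') (a + v'))"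
      by measurable
  qed (use assms in \<open>auto simp: quiet_cons algebra_simps\<close>)
  then show ?thesis by simp
qed

section \<open>Delivery after an arrival, and independence of disjoint windows\<close>

definition quiet_prob :: "real \<Rightarrow> real \<Rightarrow> real" where
  "quiet_prob b t = (\<integral>z. of_bool (quiet z b t) \<partial>law)"

lemma quiet_prob_bounds: "0 \<le> quiet_prob b t" "quiet_prob b t \<le> 1"
  unfolding quiet_prob_def by (auto intro!: law.integral_in_unit_interval)

lemma quiet_prob_shift:
  assumes "0 \<le> x" "x \<le> b"
  shows "quiet_prob (b - x) (t - x) = quiet_prob b t"
  using quiet_pair_shift[of x "b - x" "b - x" "t - x" "t - x"] assms by (simp add: quiet_prob_def)

lemma quiet_prob_empty: "t < b \<Longrightarrow> quiet_prob b t = 1"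
proof -
  assume "t < b"
  then have "AE z in law. of_bool (quiet z b t) = (1::real)"
    using AE_nonneg_seq by (auto simp: quiet_empty)
  then have "quiet_prob b t = (\<integral>z. 1 \<partial>law)"
    unfolding quiet_prob_def by (intro integral_cong_AE) auto
  then show ?thesis by simp
qed

text \<open>The state just after an arrival: an update with service time \<open>s\<close> enters service, the later
  packets are \<open>z\<close>, and neither it nor any later update is delivered within time \<open>r\<close>.\<close>

definition fresh_quiet :: "real \<Rightarrow> (nat \<Rightarrow> real \<times> real) \<Rightarrow> real \<Rightarrow> real \<Rightarrow> real \<Rightarrow> bool" where
  "fresh_quiet s z r b t \<longleftrightarrow> \<not> (s < fst (z 0) \<and> s \<le> r) \<and> quiet z 0 r \<and> quiet z b t"

lemma measurable_fresh_quiet [measurable (raw)]: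
  assumes [measurable]: "f \<in> measurable N law" "s \<in> borel_measurable N" "r \<in> borel_measurable N"
     "b \<in> borel_measurable N" "t \<in> borel_measurable N"
  shows "Measurable.pred N (\<lambda>w. fresh_quiet (s w) (f w) (r w) (b w) (t w))"
proof -
  have [measurable]: "(\<lambda>w. fst (f w 0)) \<in> borel_measurable N"
    using measurable_compose[OF assms(1) measurable_law_fst_0] .
  show ?thesis unfolding fresh_quiet_def by measurable
qed

text \<open>The later window from \<open>b\<close> to \<open>t\<close> is carried along so that a
  single renewal equation yields both the delivery law after an arrival and its independence of that
  window.\<close>

definition fresh_prob :: "real \<Rightarrow> real \<Rightarrow> real \<Rightarrow> real" where
  "fresh_prob r b t = (\<integral>s. (\<integral>z. of_bool (fresh_quiet s z r b t) \<partial>law) \<partial>exp_law m)"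

text \<open>The probability \<open>quiet_prob b t\<close> conditioned on the first interarrival time
  being \<open>x\<close>.\<close>

definition quiet_kernel :: "real \<Rightarrow> real \<Rightarrow> real \<Rightarrow> real" where
  "quiet_kernel b t x = (\<integral>s. (\<integral>z. of_bool (quiet (case_nat (x, s) z) b t) \<partial>law) \<partial>exp_law m)"

lemma measurable_quiet_kernel [measurable]: "quiet_kernel b t \<in> borel_measurable borel"
  unfolding quiet_kernel_def by measurable

lemma measurable_fresh_prob [measurable]:
  "(\<lambda>x. fresh_prob (r - x) (b - x) (t - x)) \<in> borel_measurable borel"
  unfolding fresh_prob_def by measurable

lemma quiet_kernel_bounds: "0 \<le> quiet_kernel b t x" "quiet_kernel b t x \<le> 1"
  unfolding quiet_kernel_def by (auto intro!: law.integral_in_unit_interval service.integral_in_unit_interval)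

lemma fresh_prob_bounds: "0 \<le> fresh_prob r b t" "fresh_prob r b t \<le> 1"
  unfolding fresh_prob_def by (auto intro!: law.integral_in_unit_interval service.integral_in_unit_interval)

lemma integral_quiet_kernel: "(\<integral>x. quiet_kernel b t x \<partial>exp_law l) = quiet_prob b t"
  unfolding quiet_prob_def quiet_kernel_def by (subst renewal[where B = 1]) auto

text \<open>An arrival at \<open>x < r\<close> preempts the current update, which must have
  \<open>s \<ge> x\<close> to stay undelivered; the newcomer is then in the same state with the
  clock restarted. The later window ignores the newcomer because
  \<open>x < r \<le> b\<close>.\<close>

lemma fresh_prob_step:
  assumes "0 \<le> x" "x < r" "r \<le> b"
  shows "(\<integral>s'. (\<integral>z. of_bool (fresh_quiet s (case_nat (x, s') z) r b t) \<partial>law) \<partial>exp_law m)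
    = (if s < x then 0 else 1) * fresh_prob (r - x) (b - x) (t - x)"
proof -
  have "(\<integral>z. of_bool (fresh_quiet s (case_nat (x, s') z) r b t) \<partial>law)
    = (\<integral>z. (if s < x then 0 else 1) * of_bool (fresh_quiet s' z (r - x) (b - x) (t - x)) \<partial>law :: real)" for s'
  proof (intro integral_cong_AE)
    show "AE z in law. of_bool (fresh_quiet s (case_nat (x, s') z) r b t)
      = ((if s < x then 0 else 1) * of_bool (fresh_quiet s' z (r - x) (b - x) (t - x)) :: real)"
      using AE_nonneg_seq
    proof eventually_elim
      case (elim z)
      show ?case
        using assms quiet_nonpos_left[OF elim, of "- x" "r - x"]
        by (auto simp: fresh_quiet_def quiet_cons algebra_simps)
    qed
  qed measurable
  then show ?thesis by (simp add: fresh_prob_def)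
qed

text \<open>With no arrival up to \<open>r\<close> the current update is not preempted in time, so
  the only condition on it is \<open>r < s\<close>. Everything else concerns packets after
  \<open>r\<close> and depends on \<open>x\<close> through the overshoot.\<close>

lemma fresh_prob_tail:
  assumes "0 \<le> r" "r < x" "r \<le> b"
  shows "(\<integral>s'. (\<integral>z. of_bool (fresh_quiet s (case_nat (x, s') z) r b t) \<partial>law) \<partial>exp_law m)
    = of_bool (r < s) * quiet_kernel (b - r) (t - r) (x - r)"
proof -
  have "(\<integral>s'. (\<integral>z. of_bool (fresh_quiet s (case_nat (x, s') z) r b t) \<partial>law) \<partial>exp_law m)
    = (\<integral>s'. (\<integral>z. of_bool (r < s) * of_bool (quiet (case_nat (x - r, s') z) (b - r) (t - r)) \<partial>law) \<partial>exp_law m :: real)"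
  proof (rule integral_cong_AE)
    show "AE s' in exp_law m. (\<integral>z. of_bool (fresh_quiet s (case_nat (x, s') z) r b t) \<partial>law)
      = (\<integral>z. of_bool (r < s) * of_bool (quiet (case_nat (x - r, s') z) (b - r) (t - r)) \<partial>law :: real)"
      using AE_exp_law_nonneg
    proof eventually_elim
      case (elim s')
      show ?case
      proof (intro integral_cong_AE)
        show "AE z in law. of_bool (fresh_quiet s (case_nat (x, s') z) r b t)
          = (of_bool (r < s) * of_bool (quiet (case_nat (x - r, s') z) (b - r) (t - r)) :: real)"
          using AE_nonneg_seq
        proof eventually_elim
          case z: (elim z)
          show ?case
            using assms elim quiet_negative[OF z, of "r - x" "- x"]
            by (auto simp: fresh_quiet_def quiet_cons algebra_simps)
        qed
      qed measurable
    qed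
  qed measurable
  then show ?thesis by (simp add: quiet_kernel_def)
qed

lemma integral_exp_law_gt:
  assumes "0 \<le> r"
  shows "(\<integral>s. of_bool (r < s) \<partial>exp_law m) = exp (- m * r)"
proof -
  have "(\<integral>s. of_bool (r < s) \<partial>exp_law m) = (\<integral>s. (if s < r then 0 else 1) \<partial>exp_law m :: real)"
  proof (rule integral_cong_AE)
    show "AE s in exp_law m. of_bool (r < s) = ((if s < r then 0 else 1) :: real)"
      using AE_exp_law_neq[where l = m and c = r] by eventually_elim auto
  qed measurable
  with integral_exp_law_tail[OF service_rate_pos assms] show ?thesis by simp
qed

text \<open>Negative \<open>x\<close> have probability zero; \<open>max 0 x\<close> keeps the kernel
  bounded by 1 on them too, as \<open>integral_exp_law_split\<close> demands bounds on the whole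
  line.\<close>

definition fresh_step :: "real \<Rightarrow> real \<Rightarrow> real \<Rightarrow> real \<Rightarrow> real" where
  "fresh_step r b t x = exp (- m * max 0 x) * fresh_prob (r - x) (b - x) (t - x)"

lemma measurable_fresh_step [measurable]: "fresh_step r b t \<in> borel_measurable borel"
  unfolding fresh_step_def by measurable

lemma fresh_step_bounds: "0 \<le> fresh_step r b t x" "fresh_step r b t x \<le> 1"
proof -
  have "exp (- m * max 0 x) \<le> 1" using service_rate_pos by simp
  then show "0 \<le> fresh_step r b t x" "fresh_step r b t x \<le> 1"
    unfolding fresh_step_def
    using fresh_prob_bounds[of "r - x" "b - x" "t - x"] by (auto intro: mult_le_one)
qed

lemma decayed_quiet_bounds:
  assumes "0 \<le> r" "0 \<le> y" "y \<le> 1"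
  shows "0 \<le> exp (- m * r) * y" "exp (- m * r) * y \<le> 1"
proof -
  have "exp (- m * r) \<le> 1" using service_rate_pos assms by simp
  with assms show "0 \<le> exp (- m * r) * y" "exp (- m * r) * y \<le> 1"
    by (auto intro: mult_le_one)
qed

lemma fresh_prob_renewal:
  assumes "0 \<le> r" "r \<le> b"
  shows "fresh_prob r b t = (\<integral>x. (if x < r then fresh_step r b t x else 0) \<partial>exp_law l)
    + exp (- l * r) * (exp (- m * r) * quiet_prob b t)"
proof -
  interpret sl: pair_prob_space "exp_law m" "exp_law l" ..
  let ?f = "\<lambda>s x. \<integral>s'. (\<integral>z. of_bool (fresh_quiet s (case_nat (x, s') z) r b t) \<partial>law) \<partial>exp_law m :: real"
  have f01: "0 \<le> ?f s x" "?f s x \<le> 1" for s x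
    by (auto intro!: law.integral_in_unit_interval service.integral_in_unit_interval)
  have "fresh_prob r b t = (\<integral>s. (\<integral>x. ?f s x \<partial>exp_law l) \<partial>exp_law m)"
    unfolding fresh_prob_def by (subst renewal[where B = 1]) auto
  \<comment> \<open>The order is exchanged so that, for a fixed next arrival \<open>x\<close>, the
    service time of the current update is integrated first and contributes only its survival
    factor.\<close>
  also have "\<dots> = (\<integral>x. (\<integral>s. ?f s x \<partial>exp_law m) \<partial>exp_law l)"
    using f01 by (intro sl.Fubini_integral[symmetric] sl.P.integrable_const_bound[where B = 1])
      (auto simp: case_prod_unfold)
  also have "\<dots> = (\<integral>x. (if x < r then fresh_step r b t x
      else exp (- m * r) * quiet_kernel (b - r) (t - r) (x - r)) \<partial>exp_law l)"
  proof (rule integral_cong_AE)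
    show "AE x in exp_law l. (\<integral>s. ?f s x \<partial>exp_law m) =
      (if x < r then fresh_step r b t x
       else exp (- m * r) * quiet_kernel (b - r) (t - r) (x - r))"
      using AE_exp_law_nonneg AE_exp_law_neq[where l = l and c = r]
    proof eventually_elim
      case (elim x)
      show ?case
      proof (cases "x < r")
        case True
        then show ?thesis using elim assms integral_exp_law_tail[OF service_rate_pos, of x]
          by (simp add: fresh_prob_step fresh_step_def)
      next
        case False
        then show ?thesis using elim assms
          by (simp add: fresh_prob_tail integral_exp_law_gt)
      qed
    qed
  qed measurable
  also have "\<dots> = (\<integral>x. (if x < r then fresh_step r b t x else 0) \<partial>exp_law l)
    + exp (- l * r) * (\<integral>x. exp (- m * r) * quiet_kernel (b - r) (t - r) x \<partial>exp_law l)"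
    using assms(1) arrival_rate_pos fresh_step_bounds
      decayed_quiet_bounds[OF assms(1) quiet_kernel_bounds]
    by (intro integral_exp_law_split[where B = 1]) (simp_all only: abs_of_nonneg, measurable)
  finally show ?thesis
    using assms by (simp add: integral_quiet_kernel quiet_prob_shift)
qed

text \<open>Preemption is invisible: surviving up to the next arrival costs
  \<open>exp (- m * x)\<close>, the newcomer surviving the rest costs
  \<open>exp (- m * (r - x))\<close>, and the product is free of \<open>x\<close>. Hence the
  right-hand side solves the renewal equation of \<open>fresh_prob\<close>, and uniqueness
  identifies the two.\<close>

lemma fresh_prob_eq:
  assumes "0 \<le> r" "r \<le> b"
  shows "fresh_prob r b t = exp (- m * r) * quiet_prob b t"
proof -
  define d where "d r p = fresh_prob r (fst p) (snd p) - exp (- m * r) * quiet_prob (fst p) (snd p)" for r p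
  \<comment> \<open>The later window moves with every arrival, so its endpoints form the parameter
    of \<open>renewal_unique\<close>; \<open>ok\<close> records that it stays beyond the current
    horizon.\<close>
  have "d r (b, t) = 0"
  proof (rule renewal_unique[where d = d and ok = "\<lambda>r p. r \<le> fst p", OF arrival_rate_pos])
    fix r :: real and p :: "real \<times> real" assume r: "0 \<le> r" and rb: "r \<le> fst p"
    define b t where "b = fst p" and "t = snd p"
    define c where "c = exp (- m * r) * quiet_prob b t"
    have c: "0 \<le> c" "c \<le> 1"
      unfolding c_def by (intro decayed_quiet_bounds r quiet_prob_bounds)+
    have d: "d r p = fresh_prob r b t - c" by (simp add: d_def b_def t_def c_def)
    show "\<bar>d r p\<bar> \<le> 1"
      using c fresh_prob_bounds[of r b t] unfolding d by linarith
    let ?h = "\<lambda>x. fresh_step r b t x - c"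
    have "(\<integral>x. (if x < r then ?h x else 0) \<partial>exp_law l)
        = (\<integral>x. (if x < r then fresh_step r b t x else 0) - (if x < r then 1 else 0) * c \<partial>exp_law l)"
      by (intro Bochner_Integration.integral_cong) auto
    also have "\<dots> = (\<integral>x. (if x < r then fresh_step r b t x else 0) \<partial>exp_law l)
        - (\<integral>x. (if x < r then 1 else 0) * c \<partial>exp_law l)"
      using c fresh_step_bounds
      by (intro Bochner_Integration.integral_diff arrival.integrable_const_bound[where B = 1]) auto
    also have "(\<integral>x. (if x < r then 1 else 0) * c \<partial>exp_law l) = (1 - exp (- l * r)) * c"
      using integral_exp_law_head[OF arrival_rate_pos r] by simp
    moreover have "fresh_prob r b t = (\<integral>x. (if x < r then fresh_step r b t x else 0) \<partial>exp_law l) + exp (- l * r) * c"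
      using fresh_prob_renewal[OF r, of b t] rb unfolding c_def b_def by simp
    ultimately have 1: "d r p = (\<integral>x. (if x < r then ?h x else 0) \<partial>exp_law l)"
      unfolding d by (simp add: left_diff_distrib)
    have 2: "\<bar>?h x\<bar> \<le> \<bar>d (r - x) (b - x, t - x)\<bar>" if x: "0 \<le> x" "x < r" for x
    proof -
      have "quiet_prob (b - x) (t - x) = quiet_prob b t"
        using x rb b_def by (intro quiet_prob_shift) auto
      moreover have "exp (- m * x) * exp (- m * (r - x)) = exp (- m * r)"
        by (simp add: exp_add[symmetric] algebra_simps)
      ultimately have "?h x = exp (- m * x) * d (r - x) (b - x, t - x)"
        using x by (simp add: fresh_step_def d_def c_def right_diff_distrib mult.assoc[symmetric])
      moreover have "exp (- m * x) \<le> 1" using x service_rate_pos by simp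
      ultimately show ?thesis
        by (simp add: abs_mult mult_left_le_one_le)
    qed
    show "\<exists>h. d r p = (\<integral>x. (if x < r then h x else 0) \<partial>exp_law l) \<and>
      (\<forall>x. 0 \<le> x \<longrightarrow> x < r \<longrightarrow> (\<exists>p'. r - x \<le> fst p' \<and> \<bar>h x\<bar> \<le> \<bar>d (r - x) p'\<bar>))"
    proof (intro exI[of _ ?h] conjI 1 allI impI)
      fix x assume "0 \<le> x" "x < r"
      then show "\<exists>p'. r - x \<le> fst p' \<and> \<bar>?h x\<bar> \<le> \<bar>d (r - x) p'\<bar>"
        using 2[of x] rb b_def by (intro exI[of _ "(b - x, t - x)"]) auto
    qed
  qed (use assms in auto)
  then show ?thesis by (simp add: d_def)
qed

text \<open>The tail at \<open>s\<close> of the sum of independent exponential variables of rates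
  \<open>l\<close> and \<open>m\<close>, obtained by conditioning on the first.\<close>

definition age_tail :: "real \<Rightarrow> real" where
  "age_tail s = (\<integral>x. (if x < s then exp (- m * (s - x)) else 0) \<partial>exp_law l) + exp (- l * s)"

text \<open>Conditioning on the first arrival \<open>x\<close>: if \<open>x < s\<close>, the server
  enters the fresh state with time \<open>s - x\<close> to go; otherwise nothing can be delivered by
  \<open>s\<close> and the later window sees only the overshoot. In both cases the later window
  factors out.\<close>

lemma quiet_zero_prob:
  assumes "0 \<le> s" "s \<le> b"
  shows "(\<integral>z. of_bool (quiet z 0 s \<and> quiet z b t) \<partial>law) = age_tail s * quiet_prob b t"
proof -
  have "(\<integral>z. of_bool (quiet z 0 s \<and> quiet z b t) \<partial>law :: real) =
    (\<integral>x. (\<integral>s'. (\<integral>z. of_bool (quiet (case_nat (x, s') z) 0 s \<and> quiet (case_nat (x, s') z) b t) \<partial>law) \<partial>exp_law m) \<partial>exp_law l)"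
    by (subst renewal[where B = 1]) auto
  also have "\<dots> = (\<integral>x. (if x < s then fresh_prob (s - x) (b - x) (t - x)
      else quiet_kernel (b - s) (t - s) (x - s)) \<partial>exp_law l)"
  proof (rule integral_cong_AE)
    show "AE x in exp_law l. (\<integral>s'. (\<integral>z. of_bool (quiet (case_nat (x, s') z) 0 s \<and> quiet (case_nat (x, s') z) b t) \<partial>law) \<partial>exp_law m)
      = (if x < s then fresh_prob (s - x) (b - x) (t - x) else quiet_kernel (b - s) (t - s) (x - s))"
      using AE_exp_law_nonneg AE_exp_law_neq[where l = l and c = s]
    proof eventually_elim
      case (elim x)
      have pt: "AE s' in exp_law m. (\<integral>z. of_bool (quiet (case_nat (x, s') z) 0 s \<and> quiet (case_nat (x, s') z) b t) \<partial>law)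
        = (\<integral>z. of_bool (if x < s then fresh_quiet s' z (s - x) (b - x) (t - x)
            else quiet (case_nat (x - s, s') z) (b - s) (t - s)) \<partial>law :: real)"
        using AE_exp_law_nonneg
      proof eventually_elim
        case s': (elim s')
        show ?case
        proof (intro integral_cong_AE)
          show "AE z in law. of_bool (quiet (case_nat (x, s') z) 0 s \<and> quiet (case_nat (x, s') z) b t)
            = (of_bool (if x < s then fresh_quiet s' z (s - x) (b - x) (t - x)
              else quiet (case_nat (x - s, s') z) (b - s) (t - s)) :: real)"
            using AE_nonneg_seq
          proof eventually_elim
            case z: (elim z)
            show ?case
            proof (cases "x < s")
              case True
              then show ?thesis
                using assms elim s' quiet_nonpos_left[OF z, of "- x" "s - x"]
                by (auto simp: fresh_quiet_def quiet_cons algebra_simps)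
            next
              case False
              then show ?thesis
                using assms elim s' quiet_negative[OF z, of "s - x" "- x"]
                by (auto simp: quiet_cons algebra_simps)
            qed
          qed
        qed measurable
      qed
      then have "(\<integral>s'. (\<integral>z. of_bool (quiet (case_nat (x, s') z) 0 s \<and> quiet (case_nat (x, s') z) b t) \<partial>law) \<partial>exp_law m)
        = (\<integral>s'. (\<integral>z. of_bool (if x < s then fresh_quiet s' z (s - x) (b - x) (t - x)
            else quiet (case_nat (x - s, s') z) (b - s) (t - s)) \<partial>law) \<partial>exp_law m :: real)"
        by (intro integral_cong_AE) auto
      then show ?case by (auto simp: fresh_prob_def quiet_kernel_def)
    qed
  qed measurable
  also have "\<dots> = (\<integral>x. (if x < s then fresh_prob (s - x) (b - x) (t - x) else 0) \<partial>exp_law l)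
    + exp (- l * s) * quiet_prob (b - s) (t - s)"
    unfolding integral_quiet_kernel[symmetric]
    using assms(1) arrival_rate_pos quiet_kernel_bounds fresh_prob_bounds
    by (intro integral_exp_law_split[where B = 1]) (simp_all only: abs_of_nonneg, measurable)
  also have "(\<integral>x. (if x < s then fresh_prob (s - x) (b - x) (t - x) else 0) \<partial>exp_law l)
    = (\<integral>x. (if x < s then exp (- m * (s - x)) else 0) * quiet_prob b t \<partial>exp_law l)"
  proof (rule integral_cong_AE)
    show "AE x in exp_law l. (if x < s then fresh_prob (s - x) (b - x) (t - x) else 0)
      = (if x < s then exp (- m * (s - x)) else 0) * quiet_prob b t"
      using AE_exp_law_nonneg
    proof eventually_elim
      case (elim x)
      then show ?case
        using assms fresh_prob_eq[of "s - x" "b - x" "t - x"] quiet_prob_shift[of x b t] by simp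
    qed
  qed measurable
  finally show ?thesis
    using assms quiet_prob_shift[of s b t] by (simp add: age_tail_def distrib_right)
qed

lemma quiet_pair_prob_aux:
  assumes "0 \<le> a" "a \<le> s" "s \<le> b"
  shows "(\<integral>z. of_bool (quiet z a s \<and> quiet z b t) \<partial>law) = age_tail (s - a) * quiet_prob b t"
  using quiet_pair_shift[of a 0 "b - a" "s - a" "t - a"] quiet_zero_prob[of "s - a" "b - a" "t - a"] assms
    quiet_prob_shift[of a b t] by simp

text \<open>The second interval of the pair formula is taken empty, so that its event is certain.\<close>

lemma quiet_prob_eq:
  assumes "0 \<le> a" "a \<le> s"
  shows "quiet_prob a s = age_tail (s - a)"
proof -
  have "(\<integral>z. of_bool (quiet z a s \<and> quiet z (s + 1) s) \<partial>law) = age_tail (s - a)"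
    using quiet_pair_prob_aux[of a s "s + 1" s] assms by (simp add: quiet_prob_empty)
  moreover have "(\<integral>z. of_bool (quiet z a s \<and> quiet z (s + 1) s) \<partial>law) = quiet_prob a s"
    unfolding quiet_prob_def
  proof (rule integral_cong_AE)
    show "AE z in law. of_bool (quiet z a s \<and> quiet z (s + 1) s) = (of_bool (quiet z a s) :: real)"
      using AE_nonneg_seq by eventually_elim (simp add: quiet_empty)
  qed measurable
  ultimately show ?thesis by simp
qed

lemma quiet_pair_prob:
  assumes "0 \<le> a" "a \<le> s" "s \<le> b" "b \<le> t"
  shows "(\<integral>z. of_bool (quiet z a s \<and> quiet z b t) \<partial>law) = age_tail (s - a) * age_tail (t - b)"
  using quiet_pair_prob_aux[of a s b t] quiet_prob_eq[of b t] assms by simp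

end

section \<open>Two independent servers\<close>

lemma (in prob_space) distr_exponential:
  assumes "distributed M lborel X (exponential_density l)"
  shows "distr M borel X = exp_law l"
proof -
  have "distr M borel X = distr M lborel X" by (rule distr_cong) auto
  also have "\<dots> = exp_law l"
    unfolding exp_law_def using assms by (rule distributed_distr_eq_density)
  finally show ?thesis .
qed

definition packets :: "(nat \<Rightarrow> nat \<Rightarrow> 'a \<Rightarrow> real) \<Rightarrow> (nat \<Rightarrow> nat \<Rightarrow> 'a \<Rightarrow> real) \<Rightarrow> nat \<Rightarrow> 'a \<Rightarrow> nat \<Rightarrow> real \<times> real" where
  "packets X S j w k = (X j k w, S j k w)"

context prob_space
begin

context
  fixes X S :: "nat \<Rightarrow> nat \<Rightarrow> 'a \<Rightarrow> real" and l m :: "nat \<Rightarrow> real" and J :: "nat set"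
  assumes dX: "\<And>j k. j \<in> J \<Longrightarrow> distributed M lborel (X j k) (exponential_density (l j))"
    and dS: "\<And>j k. j \<in> J \<Longrightarrow> distributed M lborel (S j k) (exponential_density (m j))"
    and indep: "indep_vars (\<lambda>_. borel) (case_sum (\<lambda>(j, k). X j k) (\<lambda>(j, k). S j k))
           ((J \<times> UNIV) <+> (J \<times> UNIV))"
begin

text \<open>Grouping an independent family along the disjoint index blocks
  \<open>{Inl jk, Inr jk}\<close> keeps it independent. The same device, with rows
  \<open>{j} \<times> UNIV\<close> as blocks, later separates the servers.\<close>

lemma indep_packets:
  "indep_vars (\<lambda>_. borel \<Otimes>\<^sub>M borel) (\<lambda>jk w. (X (fst jk) (snd jk) w, S (fst jk) (snd jk) w)) (J \<times> UNIV)"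
proof -
  let ?V = "case_sum (\<lambda>(j, k). X j k) (\<lambda>(j, k). S j k)"
  let ?K = "\<lambda>jk :: nat \<times> nat. {Inl jk, Inr jk :: nat \<times> nat + nat \<times> nat}"
  have "indep_vars (\<lambda>jk. PiM (?K jk) (\<lambda>_. borel)) (\<lambda>jk w. restrict (\<lambda>i. ?V i w) (?K jk)) (J \<times> UNIV)"
    by (rule indep_vars_restrict[OF indep]) (auto simp: disjoint_family_on_def)
  then have "indep_vars (\<lambda>_. borel \<Otimes>\<^sub>M borel)
      (\<lambda>jk w. (\<lambda>f. (f (Inl jk), f (Inr jk))) (restrict (\<lambda>i. ?V i w) (?K jk))) (J \<times> UNIV)"
    by (rule indep_vars_compose2) (auto intro!: measurable_Pair measurable_component_singleton)
  then show ?thesis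
    by (simp add: case_prod_unfold)
qed

lemma distr_packet:
  assumes "j \<in> J"
  shows "distr M (borel \<Otimes>\<^sub>M borel) (\<lambda>w. (X j k w, S j k w)) = exp_law (l j) \<Otimes>\<^sub>M exp_law (m j)"
proof -
  let ?V = "case_sum (\<lambda>(j, k). X j k) (\<lambda>(j, k). S j k)"
  let ?A = "{Inl (j, k) :: nat \<times> nat + nat \<times> nat}" and ?B = "{Inr (j, k) :: nat \<times> nat + nat \<times> nat}"
  have "indep_var (PiM ?A (\<lambda>_. borel)) (\<lambda>w. restrict (\<lambda>i. ?V i w) ?A) (PiM ?B (\<lambda>_. borel)) (\<lambda>w. restrict (\<lambda>i. ?V i w) ?B)"
    using assms by (intro indep_var_restrict[OF indep]) auto
  then have "indep_var borel ((\<lambda>f. f (Inl (j, k))) \<circ> (\<lambda>w. restrict (\<lambda>i. ?V i w) ?A))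
      borel ((\<lambda>f. f (Inr (j, k))) \<circ> (\<lambda>w. restrict (\<lambda>i. ?V i w) ?B))"
    by (rule indep_var_compose) (auto intro!: measurable_component_singleton)
  then have "indep_var borel (X j k) borel (S j k)"
    by (simp add: comp_def)
  then show ?thesis
    unfolding indep_var_distribution_eq
    using distr_exponential[OF dX[OF assms], of k] distr_exponential[OF dS[OF assms], of k] by simp
qed

lemma distr_packets:
  assumes "j \<in> J"
  shows "distr M (PiM UNIV (\<lambda>_. borel \<Otimes>\<^sub>M borel)) (packets X S j) = PiM UNIV (\<lambda>_. exp_law (l j) \<Otimes>\<^sub>M exp_law (m j))"
proof -
  let ?P = "\<lambda>k w. (X j k w, S j k w)"
  have ind: "indep_vars (\<lambda>_. borel \<Otimes>\<^sub>M borel) ?P UNIV"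
  proof -
    have "indep_vars (\<lambda>k. PiM {(j, k)} (\<lambda>_. borel \<Otimes>\<^sub>M borel))
        (\<lambda>k w. restrict (\<lambda>jk. (X (fst jk) (snd jk) w, S (fst jk) (snd jk) w)) {(j, k)}) UNIV"
      using assms by (intro indep_vars_restrict[OF indep_packets]) (auto simp: disjoint_family_on_def)
    then have "indep_vars (\<lambda>_. borel \<Otimes>\<^sub>M borel)
        (\<lambda>k w. (\<lambda>f. f (j, k)) (restrict (\<lambda>jk. (X (fst jk) (snd jk) w, S (fst jk) (snd jk) w)) {(j, k)})) UNIV"
      by (rule indep_vars_compose2) (auto intro!: measurable_component_singleton)
    then show ?thesis by simp
  qed
  then have rv: "random_variable (borel \<Otimes>\<^sub>M borel) (?P k)" for k
    unfolding indep_vars_def by auto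
  have "distr M (PiM UNIV (\<lambda>_. borel \<Otimes>\<^sub>M borel)) (\<lambda>w. \<lambda>k\<in>UNIV. ?P k w)
      = PiM UNIV (\<lambda>k. distr M (borel \<Otimes>\<^sub>M borel) (?P k))"
    using ind rv by (subst indep_vars_iff_distr_eq_PiM'[symmetric]) auto
  then show ?thesis
    using distr_packet[OF assms] by (simp add: packets_def [abs_def] restrict_def)
qed

lemma measurable_packets:
  assumes "j \<in> J"
  shows "packets X S j \<in> measurable M (PiM UNIV (\<lambda>_. borel \<Otimes>\<^sub>M borel))"
proof -
  have [measurable]: "X j k \<in> borel_measurable M" "S j k \<in> borel_measurable M" for k
    using distributed_measurable[OF dX[OF assms]] distributed_measurable[OF dS[OF assms]] by auto
  show ?thesis unfolding packets_def[abs_def] by (rule measurable_PiM_single') (auto simp: space_pair_measure)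
qed

lemma indep_packets_servers:
  assumes "i \<in> J" "j \<in> J" "i \<noteq> j"
  shows "indep_var (PiM UNIV (\<lambda>_. borel \<Otimes>\<^sub>M borel)) (packets X S i) (PiM UNIV (\<lambda>_. borel \<Otimes>\<^sub>M borel)) (packets X S j)"
proof -
  let ?P = "\<lambda>jk w. (X (fst jk) (snd jk) w, S (fst jk) (snd jk) w)"
  let ?A = "\<lambda>j. {j} \<times> UNIV :: (nat \<times> nat) set"
  have ind: "indep_var (PiM (?A i) (\<lambda>_. borel \<Otimes>\<^sub>M borel)) (\<lambda>w. restrict (\<lambda>jk. ?P jk w) (?A i))
      (PiM (?A j) (\<lambda>_. borel \<Otimes>\<^sub>M borel)) (\<lambda>w. restrict (\<lambda>jk. ?P jk w) (?A j))"
    using assms by (intro indep_var_restrict[OF indep_packets]) auto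
  have meas: "(\<lambda>f k. f (j, k)) \<in> measurable (PiM (?A j) (\<lambda>_. borel \<Otimes>\<^sub>M borel)) (PiM UNIV (\<lambda>_. borel \<Otimes>\<^sub>M borel :: (real \<times> real) measure))" for j
  proof (rule measurable_PiM_single'[where f = "\<lambda>k f. f (j, k)"])
    show "(\<lambda>f. f (j, k)) \<in> measurable (PiM (?A j) (\<lambda>_. borel \<Otimes>\<^sub>M borel)) (borel \<Otimes>\<^sub>M borel :: (real \<times> real) measure)" for k
      by (rule measurable_component_singleton) simp
  qed (auto simp: space_pair_measure)
  have "indep_var (PiM UNIV (\<lambda>_. borel \<Otimes>\<^sub>M borel)) ((\<lambda>f k. f (i, k)) \<circ> (\<lambda>w. restrict (\<lambda>jk. ?P jk w) (?A i)))
      (PiM UNIV (\<lambda>_. borel \<Otimes>\<^sub>M borel)) ((\<lambda>f k. f (j, k)) \<circ> (\<lambda>w. restrict (\<lambda>jk. ?P jk w) (?A j)))"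
    by (rule indep_var_compose[OF ind meas meas])
  then show ?thesis by (simp add: comp_def packets_def[abs_def])
qed

lemma distr_packets_law:
  assumes "j \<in> J" "0 < l j" "0 < m j"
  shows "packets X S j \<in> measurable M (server.law (l j) (m j))"
    and "distr M (server.law (l j) (m j)) (packets X S j) = server.law (l j) (m j)"
proof -
  interpret server "l j" "m j" using assms by unfold_locales
  show "packets X S j \<in> measurable M law"
    using measurable_packets[OF assms(1)] by (simp cong: measurable_cong_sets add: sets_law)
  have "distr M law (packets X S j) = distr M (PiM UNIV (\<lambda>_. borel \<Otimes>\<^sub>M borel)) (packets X S j)"
    by (rule distr_cong) (simp_all add: sets_law)
  then show "distr M law (packets X S j) = law"
    unfolding distr_packets[OF assms(1)] by (simp add: law_def)
qed

lemma prob_packets: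
  assumes j: "j \<in> J" "0 < l j" "0 < m j" and P: "Measurable.pred (server.law (l j) (m j)) P"
  shows "prob {w \<in> space M. P (packets X S j w)} = (\<integral>z. of_bool (P z) \<partial>server.law (l j) (m j))"
proof -
  note [measurable] = P distr_packets_law(1)[OF j]
  have "(\<integral>z. of_bool (P z) \<partial>server.law (l j) (m j)) = (\<integral>z. of_bool (P z) \<partial>distr M (server.law (l j) (m j)) (packets X S j) :: real)"
    by (simp add: distr_packets_law(2)[OF j])
  also have "\<dots> = (\<integral>w. of_bool (P (packets X S j w)) \<partial>M)"
    by (rule integral_distr) measurable
  also have "\<dots> = (\<integral>w. indicator {w \<in> space M. P (packets X S j w)} w \<partial>M)"
    by (intro Bochner_Integration.integral_cong) (auto simp: indicator_def)
  also have "\<dots> = prob {w \<in> space M. P (packets X S j w)}"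
    by (simp add: Int_absorb1 Collect_conj_eq)
  finally show ?thesis by simp
qed

lemma prob_packets_pair:
  assumes i: "i \<in> J" "0 < l i" "0 < m i" and j: "j \<in> J" "0 < l j" "0 < m j" and "i \<noteq> j"
    and P: "Measurable.pred (server.law (l i) (m i)) P" and Q: "Measurable.pred (server.law (l j) (m j)) Q"
  shows "prob {w \<in> space M. P (packets X S i w) \<and> Q (packets X S j w)}
    = (\<integral>z. of_bool (P z) \<partial>server.law (l i) (m i)) * (\<integral>z. of_bool (Q z) \<partial>server.law (l j) (m j))"
proof -
  interpret I: server "l i" "m i" using i by unfold_locales
  interpret J: server "l j" "m j" using j by unfold_locales
  have PS: "{z. P z} \<in> sets (PiM UNIV (\<lambda>_. borel \<Otimes>\<^sub>M borel))"
    using P by (simp add: pred_def I.sets_law)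
  have QS: "{z. Q z} \<in> sets (PiM UNIV (\<lambda>_. borel \<Otimes>\<^sub>M borel))"
    using Q by (simp add: pred_def J.sets_law)
  have "prob {w \<in> space M. P (packets X S i w) \<and> Q (packets X S j w)}
      = prob ((\<lambda>w. (packets X S i w, packets X S j w)) -` ({z. P z} \<times> {z. Q z}) \<inter> space M)"
    by (rule arg_cong[where f = prob]) auto
  also have "\<dots> = prob (packets X S i -` {z. P z} \<inter> space M) * prob (packets X S j -` {z. Q z} \<inter> space M)"
    by (rule indep_varD[OF indep_packets_servers[OF i(1) j(1) \<open>i \<noteq> j\<close>] PS QS])
  also have "packets X S i -` {z. P z} \<inter> space M = {w \<in> space M. P (packets X S i w)}" by auto
  also have "packets X S j -` {z. Q z} \<inter> space M = {w \<in> space M. Q (packets X S j w)}" by auto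
  finally show ?thesis
    by (simp add: prob_packets[OF i P] prob_packets[OF j Q])
qed

lemma AE_packets_nonneg:
  assumes j: "j \<in> J" "0 < l j" "0 < m j"
  shows "AE w in M. nonneg_seq (packets X S j w)"
proof -
  interpret server "l j" "m j" using j by unfold_locales
  have "AE z in distr M law (packets X S j). nonneg_seq z"
    unfolding distr_packets_law(2)[OF j] by (rule AE_nonneg_seq)
  then show ?thesis by (rule AE_distrD[OF distr_packets_law(1)[OF j]])
qed

end

end

section \<open>Averages of weakly correlated random areas\<close>

text \<open>Monotonicity traps \<open>f T / T\<close> between its values at consecutive squares.
  Squares are sparse enough for errors of order \<open>1 / T\<close> to be summable along them, yet
  the ratio of consecutive squares still tends to 1.\<close>

lemma average_tendsto_of_squares:
  fixes f :: "real \<Rightarrow> real"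
  assumes mono: "\<And>x y. 0 \<le> x \<Longrightarrow> x \<le> y \<Longrightarrow> f x \<le> f y" and nonneg: "\<And>x. 0 \<le> x \<Longrightarrow> 0 \<le> f x"
    and lim: "(\<lambda>n. f ((real n)\<^sup>2) / (real n)\<^sup>2) \<longlonglongrightarrow> c"
  shows "((\<lambda>T. f T / T) \<longlongrightarrow> c) at_top"
proof -
  define m where "m T = nat \<lfloor>sqrt T\<rfloor>" for T
  define u where "u n = f ((real n)\<^sup>2) / (real n)\<^sup>2" for n :: nat
  have m: "filterlim m at_top at_top"
    unfolding m_def
    by (intro filterlim_compose[OF filterlim_nat_sequentially]
        filterlim_compose[OF filterlim_floor_sequentially] sqrt_at_top)
  have r: "(\<lambda>n. (real n / (real n + 1))\<^sup>2) \<longlonglongrightarrow> 1\<^sup>2"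
    by (intro tendsto_power) real_asymp
  have r': "(\<lambda>n. ((real n + 1) / real n)\<^sup>2) \<longlonglongrightarrow> 1\<^sup>2"
    by (intro tendsto_power) real_asymp
  have lo: "(\<lambda>n. u n * (real n / (real n + 1))\<^sup>2) \<longlonglongrightarrow> c"
    using tendsto_mult[OF lim r] by (simp add: u_def)
  have hi: "(\<lambda>n. u (Suc n) * ((real n + 1) / real n)\<^sup>2) \<longlonglongrightarrow> c"
    using tendsto_mult[OF filterlim_compose[OF lim filterlim_Suc] r'] by (simp add: u_def)
  have bounds: "u (m T) * (real (m T) / (real (m T) + 1))\<^sup>2 \<le> f T / T \<and>
      f T / T \<le> u (Suc (m T)) * ((real (m T) + 1) / real (m T))\<^sup>2" if "1 \<le> T" for T
  proof -
    define k where "k = real (m T)"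
    have T: "0 < T" using that by simp
    have s1: "1 \<le> sqrt T" using that by simp
    have k: "k \<le> sqrt T" "sqrt T < k + 1" "1 \<le> k"
      using s1 by (auto simp: k_def m_def)
    have k2: "k\<^sup>2 \<le> T" "T \<le> (k + 1)\<^sup>2"
    proof -
      have "k\<^sup>2 \<le> (sqrt T)\<^sup>2" using k by (intro power_mono) auto
      moreover have "(sqrt T)\<^sup>2 \<le> (k + 1)\<^sup>2" using k T by (intro power_mono) auto
      ultimately show "k\<^sup>2 \<le> T" "T \<le> (k + 1)\<^sup>2" using T by auto
    qed
    have "f (k\<^sup>2) / (k + 1)\<^sup>2 \<le> f T / T"
      using k2 T k by (intro frac_le nonneg mono) auto
    moreover have "f T / T \<le> f ((k + 1)\<^sup>2) / k\<^sup>2"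
      using k2 T k by (intro frac_le nonneg mono) auto
    moreover have "u (m T) * (real (m T) / (real (m T) + 1))\<^sup>2 = f (k\<^sup>2) / (k + 1)\<^sup>2"
      using k by (simp add: u_def k_def power_divide)
    moreover have "u (Suc (m T)) * ((real (m T) + 1) / real (m T))\<^sup>2 = f ((k + 1)\<^sup>2) / k\<^sup>2"
      using k by (simp add: u_def k_def power_divide add.commute)
    ultimately show ?thesis by simp
  qed
  show ?thesis
  proof (rule tendsto_sandwich)
    show "\<forall>\<^sub>F T in at_top. u (m T) * (real (m T) / (real (m T) + 1))\<^sup>2 \<le> f T / T"
      using eventually_ge_at_top[of 1] by eventually_elim (use bounds in auto)
    show "\<forall>\<^sub>F T in at_top. f T / T \<le> u (Suc (m T)) * ((real (m T) + 1) / real (m T))\<^sup>2"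
      using eventually_ge_at_top[of 1] by eventually_elim (use bounds in auto)
    show "((\<lambda>T. u (m T) * (real (m T) / (real (m T) + 1))\<^sup>2) \<longlongrightarrow> c) at_top"
      by (rule filterlim_compose[OF lo m])
    show "((\<lambda>T. u (Suc (m T)) * ((real (m T) + 1) / real (m T))\<^sup>2) \<longlongrightarrow> c) at_top"
      by (rule filterlim_compose[OF hi m])
  qed
qed

text \<open>After division by \<open>T\<close> the second moments are at most \<open>K / T\<close>.
  Along squares their sum is finite, so the series of squared deviations converges almost surely and
  its terms vanish.\<close>

lemma AE_average_tendsto:
  fixes A :: "real \<Rightarrow> 'a \<Rightarrow> real"
  assumes [measurable]: "\<And>T. A T \<in> borel_measurable M"
    and mono: "\<And>w x y. 0 \<le> x \<Longrightarrow> x \<le> y \<Longrightarrow> A x w \<le> A y w"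
    and nonneg: "\<And>w x. 0 \<le> x \<Longrightarrow> 0 \<le> A x w"
    and second_moment: "\<And>T. 1 \<le> T \<Longrightarrow> (\<integral>\<^sup>+w. ennreal ((A T w - c * T)\<^sup>2) \<partial>M) \<le> ennreal (K * T)"
    and "0 \<le> K"
  shows "AE w in M. ((\<lambda>T. A T w / T) \<longlongrightarrow> c) at_top"
proof -
  \<comment> \<open>\<open>Suc n\<close> starts the squares at 1, where the second moment bound
    begins to apply and no division by zero occurs.\<close>
  define e where "e n w = ((A ((real (Suc n))\<^sup>2) w - c * (real (Suc n))\<^sup>2) / (real (Suc n))\<^sup>2)\<^sup>2" for n w
  have [measurable]: "e n \<in> borel_measurable M" for n unfolding e_def by measurable
  have e0: "0 \<le> e n w" for n w by (simp add: e_def)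
  have bound: "(\<integral>\<^sup>+w. ennreal (e n w) \<partial>M) \<le> ennreal (K * (1 / (real (Suc n))\<^sup>2))" for n
  proof -
    define T where "T = (real (Suc n))\<^sup>2"
    have T: "1 \<le> T" by (simp add: T_def)
    have "(\<integral>\<^sup>+w. ennreal (e n w) \<partial>M) = (\<integral>\<^sup>+w. ennreal (1 / T\<^sup>2) * ennreal ((A T w - c * T)\<^sup>2) \<partial>M)"
      unfolding e_def T_def[symmetric]
      by (intro nn_integral_cong) (simp add: power_divide ennreal_mult[symmetric])
    also have "\<dots> = ennreal (1 / T\<^sup>2) * (\<integral>\<^sup>+w. ennreal ((A T w - c * T)\<^sup>2) \<partial>M)"
      by (intro nn_integral_cmult) auto
    also have "\<dots> \<le> ennreal (1 / T\<^sup>2) * ennreal (K * T)"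
      by (intro mult_left_mono second_moment T) auto
    also have "\<dots> = ennreal (1 / T\<^sup>2 * (K * T))"
      using T \<open>0 \<le> K\<close> by (intro ennreal_mult[symmetric]) auto
    also have "1 / T\<^sup>2 * (K * T) = K * (1 / T)"
      using T by (simp add: power2_eq_square)
    finally show ?thesis by (simp add: T_def)
  qed
  have sumK: "summable (\<lambda>n. K * (1 / (real (Suc n))\<^sup>2))"
  proof (intro summable_mult)
    have "summable (\<lambda>n. inverse (real n ^ 2))" by (rule inverse_power_summable) simp
    then show "summable (\<lambda>n. 1 / (real (Suc n))\<^sup>2)"
      by (subst (asm) summable_Suc_iff[symmetric]) (simp add: divide_inverse)
  qed
  have "(\<integral>\<^sup>+w. (\<Sum>n. ennreal (e n w)) \<partial>M) = (\<Sum>n. (\<integral>\<^sup>+w. ennreal (e n w) \<partial>M))"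
    by (intro nn_integral_suminf) auto
  also have "\<dots> \<le> (\<Sum>n. ennreal (K * (1 / (real (Suc n))\<^sup>2)))"
    by (intro suminf_le bound) auto
  also have "\<dots> = ennreal (\<Sum>n. K * (1 / (real (Suc n))\<^sup>2))"
    using sumK \<open>0 \<le> K\<close> by (intro suminf_ennreal2) auto
  also have "\<dots> < \<infinity>" by simp
  finally have "(\<integral>\<^sup>+w. (\<Sum>n. ennreal (e n w)) \<partial>M) \<noteq> \<infinity>" by simp
  then have "AE w in M. (\<Sum>n. ennreal (e n w)) \<noteq> \<infinity>"
    by (intro nn_integral_PInf_AE) auto
  then show ?thesis
  proof eventually_elim
    case (elim w)
    then have "summable (\<lambda>n. e n w)"
      by (intro summable_suminf_not_top e0) auto
    then have "(\<lambda>n. sqrt (e n w)) \<longlonglongrightarrow> sqrt 0"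
      by (intro tendsto_real_sqrt summable_LIMSEQ_zero)
    then have "(\<lambda>n. \<bar>(A ((real (Suc n))\<^sup>2) w - c * (real (Suc n))\<^sup>2) / (real (Suc n))\<^sup>2\<bar>) \<longlonglongrightarrow> 0"
      by (simp add: e_def)
    then have "(\<lambda>n. (A ((real (Suc n))\<^sup>2) w - c * (real (Suc n))\<^sup>2) / (real (Suc n))\<^sup>2) \<longlonglongrightarrow> 0"
      by (rule tendsto_rabs_zero_cancel)
    then have "(\<lambda>n. (A ((real (Suc n))\<^sup>2) w - c * (real (Suc n))\<^sup>2) / (real (Suc n))\<^sup>2 + c) \<longlonglongrightarrow> 0 + c"
      by (intro tendsto_intros)
    moreover have "(A ((real (Suc n))\<^sup>2) w - c * (real (Suc n))\<^sup>2) / (real (Suc n))\<^sup>2 + c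
        = A ((real (Suc n))\<^sup>2) w / (real (Suc n))\<^sup>2" for n
      by (simp add: diff_divide_distrib del: of_nat_Suc)
    ultimately have "(\<lambda>n. A ((real (Suc n))\<^sup>2) w / (real (Suc n))\<^sup>2) \<longlonglongrightarrow> c" by simp
    then have "(\<lambda>n. A ((real n)\<^sup>2) w / (real n)\<^sup>2) \<longlonglongrightarrow> c"
      by (rule LIMSEQ_imp_Suc)
    then show ?case
      by (intro average_tendsto_of_squares mono nonneg)
  qed
qed

section \<open>Exponential kernels and integrals over the wedge\<close>

text \<open>Up to the factor \<open>1 / \<kappa>\<close> the centred integrand is dominated by the
  exponential density plus its reflection, each of total mass 1.\<close>

lemma nn_integral_exp_abs:
  fixes \<kappa> y :: real
  assumes "0 < \<kappa>"
  shows "(\<integral>\<^sup>+x. ennreal (exp (- \<kappa> * \<bar>x - y\<bar>)) \<partial>lborel) \<le> ennreal (2 / \<kappa>)"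
proof -
  have one: "(\<integral>\<^sup>+x. ennreal (exponential_density \<kappa> x) \<partial>lborel) = 1"
    using prob_space.emeasure_space_1[OF prob_space_exponential_density[OF assms]]
    by (simp add: emeasure_density cong: nn_integral_cong)
  have refl: "(\<integral>\<^sup>+x. ennreal (exponential_density \<kappa> (- x)) \<partial>lborel) = 1"
    using one nn_integral_real_affine[of "\<lambda>x. ennreal (exponential_density \<kappa> x)" "- 1" 0] by simp
  have "(\<integral>\<^sup>+x. ennreal (exp (- \<kappa> * \<bar>x - y\<bar>)) \<partial>lborel) = (\<integral>\<^sup>+x. ennreal (exp (- \<kappa> * \<bar>x\<bar>)) \<partial>lborel)"
    using nn_integral_real_affine[of "\<lambda>x. ennreal (exp (- \<kappa> * \<bar>x - y\<bar>))" 1 y] by simp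
  also have "\<dots> \<le> (\<integral>\<^sup>+x. ennreal (1 / \<kappa>) * (ennreal (exponential_density \<kappa> x) + ennreal (exponential_density \<kappa> (- x))) \<partial>lborel)"
  proof (rule nn_integral_mono)
    fix x :: real
    have "exp (- \<kappa> * \<bar>x\<bar>) \<le> 1 / \<kappa> * (exponential_density \<kappa> x + exponential_density \<kappa> (- x))"
      using assms by (auto simp: exponential_density_def abs_if field_simps)
    then show "ennreal (exp (- \<kappa> * \<bar>x\<bar>)) \<le> ennreal (1 / \<kappa>) * (ennreal (exponential_density \<kappa> x) + ennreal (exponential_density \<kappa> (- x)))"
      using assms exponential_density_nonneg[OF assms]
      by (subst ennreal_plus[symmetric], simp, simp, subst ennreal_mult[symmetric]) (auto intro: ennreal_leI)
  qed
  also have "\<dots> = ennreal (1 / \<kappa>) * (1 + 1)"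
    by (subst nn_integral_cmult, simp, subst nn_integral_add) (simp_all add: one refl)
  also have "\<dots> = ennreal (2 / \<kappa>)"
    using assms by (subst one_add_one) (simp add: ennreal_mult[symmetric] flip: ennreal_numeral)
  finally show ?thesis .
qed

lemma nn_integral_translate:
  fixes f :: "real \<Rightarrow> ennreal"
  assumes "f \<in> borel_measurable borel"
  shows "(\<integral>\<^sup>+x. f (x - a) \<partial>lborel) = (\<integral>\<^sup>+x. f x \<partial>lborel)"
  using nn_integral_real_affine[of "\<lambda>x. f (x - a)" 1 a] assms by simp

lemma (in prob_space) nn_integral_of_bool_prob:
  assumes [measurable]: "Measurable.pred M P"
  shows "(\<integral>\<^sup>+w. of_bool (P w) \<partial>M) = ennreal (prob {w \<in> space M. P w})"
proof -
  have "(\<integral>\<^sup>+w. of_bool (P w) \<partial>M) = (\<integral>\<^sup>+w. indicator {w \<in> space M. P w} w \<partial>M)"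
    by (intro nn_integral_cong) (auto simp: indicator_def)
  also have "\<dots> = emeasure M {w \<in> space M. P w}" by (intro nn_integral_indicator) auto
  finally show ?thesis by (simp add: emeasure_eq_measure)
qed

definition wedge :: "real \<Rightarrow> (real \<times> real) set" where
  "wedge T = {(a, t). 0 \<le> a \<and> a \<le> t \<and> t \<le> T}"

lemma wedge_sets [measurable]: "wedge T \<in> sets (lborel \<Otimes>\<^sub>M lborel)"
proof -
  have "wedge T = {p \<in> space (lborel \<Otimes>\<^sub>M lborel). 0 \<le> fst p \<and> fst p \<le> snd p \<and> snd p \<le> T}"
    by (auto simp: wedge_def space_pair_measure)
  also have "\<dots> \<in> sets (lborel \<Otimes>\<^sub>M lborel)" by measurable
  finally show ?thesis .
qed

lemma wedge_mono: "x \<le> y \<Longrightarrow> wedge x \<subseteq> wedge y"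
  by (auto simp: wedge_def)

lemma nn_integral_wedge:
  assumes "f \<in> borel_measurable (lborel \<Otimes>\<^sub>M lborel)"
  shows "(\<integral>\<^sup>+p. f p * indicator (wedge T) p \<partial>(lborel \<Otimes>\<^sub>M lborel))
    = (\<integral>\<^sup>+a. (\<integral>\<^sup>+t. f (a, t) * indicator (wedge T) (a, t) \<partial>lborel) \<partial>lborel)"
  using assms by (subst lborel.nn_integral_fst[symmetric]) auto

text \<open>Dominates the correlation of two overlapping age intervals; integrating out three of the
  four coordinates leaves a variance that grows only linearly in the horizon.\<close>

definition cov_kernel :: "real \<Rightarrow> real \<times> real \<Rightarrow> real \<times> real \<Rightarrow> real" where
  "cov_kernel \<kappa> p q = exp (- \<kappa> * \<bar>snd p - fst p\<bar>) * exp (- \<kappa> * \<bar>fst q - fst p\<bar>) * exp (- \<kappa> * \<bar>snd q - fst q\<bar>)"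

text \<open>The kernel is a chain through \<open>snd p\<close>, \<open>fst p\<close>,
  \<open>fst q\<close>, \<open>snd q\<close>. Peeled off from the \<open>q\<close> end, each of its
  three links costs at most \<open>2 / \<kappa>\<close>, hence the cube; only \<open>fst p\<close>
  remains confined to \<open>{0..T}\<close>.\<close>

lemma nn_integral_cov_kernel:
  assumes "0 < \<kappa>" "0 \<le> T"
  shows "(\<integral>\<^sup>+p. (\<integral>\<^sup>+q. ennreal (cov_kernel \<kappa> p q) * indicator (wedge T) q \<partial>(lborel \<Otimes>\<^sub>M lborel)) * indicator (wedge T) p \<partial>(lborel \<Otimes>\<^sub>M lborel))
    \<le> ennreal ((2 / \<kappa>) ^ 3 * T)"
proof -
  let ?E = "\<lambda>x y. ennreal (exp (- \<kappa> * \<bar>x - y\<bar>))"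
  have inner: "(\<integral>\<^sup>+q. ennreal (cov_kernel \<kappa> p q) * indicator (wedge T) q \<partial>(lborel \<Otimes>\<^sub>M lborel))
    \<le> ennreal ((2 / \<kappa>)\<^sup>2) * ?E (snd p) (fst p)" for p
  proof -
    have "(\<integral>\<^sup>+q. ennreal (cov_kernel \<kappa> p q) * indicator (wedge T) q \<partial>(lborel \<Otimes>\<^sub>M lborel))
      \<le> (\<integral>\<^sup>+q. ?E (snd p) (fst p) * (?E (fst q) (fst p) * ?E (snd q) (fst q)) \<partial>(lborel \<Otimes>\<^sub>M lborel))"
      by (intro nn_integral_mono) (auto simp: cov_kernel_def indicator_def ennreal_mult[symmetric] mult.assoc)
    also have "\<dots> = (\<integral>\<^sup>+b. (\<integral>\<^sup>+t. ?E (snd p) (fst p) * (?E b (fst p) * ?E t b) \<partial>lborel) \<partial>lborel)"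
      by (subst lborel.nn_integral_fst[symmetric]) (auto simp: case_prod_unfold)
    also have "\<dots> = (\<integral>\<^sup>+b. ?E (snd p) (fst p) * (?E b (fst p) * (\<integral>\<^sup>+t. ?E t b \<partial>lborel)) \<partial>lborel)"
      by (simp add: nn_integral_cmult)
    also have "\<dots> \<le> (\<integral>\<^sup>+b. ?E (snd p) (fst p) * (?E b (fst p) * ennreal (2 / \<kappa>)) \<partial>lborel)"
      using assms by (intro nn_integral_mono mult_left_mono nn_integral_exp_abs) auto
    also have "\<dots> = ?E (snd p) (fst p) * ((\<integral>\<^sup>+b. ?E b (fst p) \<partial>lborel) * ennreal (2 / \<kappa>))"
      by (simp add: nn_integral_cmult nn_integral_multc)
    also have "\<dots> \<le> ?E (snd p) (fst p) * (ennreal (2 / \<kappa>) * ennreal (2 / \<kappa>))"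
      using assms by (intro mult_left_mono mult_right_mono nn_integral_exp_abs) auto
    also have "\<dots> = ennreal ((2 / \<kappa>)\<^sup>2) * ?E (snd p) (fst p)"
      using assms by (simp add: ennreal_mult[symmetric] power2_eq_square mult.commute)
    finally show ?thesis .
  qed
  have "(\<integral>\<^sup>+p. (\<integral>\<^sup>+q. ennreal (cov_kernel \<kappa> p q) * indicator (wedge T) q \<partial>(lborel \<Otimes>\<^sub>M lborel)) * indicator (wedge T) p \<partial>(lborel \<Otimes>\<^sub>M lborel))
    \<le> (\<integral>\<^sup>+p. ennreal ((2 / \<kappa>)\<^sup>2) * (?E (snd p) (fst p) * indicator {0..T} (fst p)) \<partial>(lborel \<Otimes>\<^sub>M lborel))"
  proof (intro nn_integral_mono)
    fix p :: "real \<times> real"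
    have "(indicator (wedge T) p :: ennreal) \<le> indicator {0..T} (fst p)"
      by (auto simp: wedge_def indicator_def)
    with inner[of p] have "(\<integral>\<^sup>+q. ennreal (cov_kernel \<kappa> p q) * indicator (wedge T) q \<partial>(lborel \<Otimes>\<^sub>M lborel)) * indicator (wedge T) p
      \<le> (ennreal ((2 / \<kappa>)\<^sup>2) * ?E (snd p) (fst p)) * indicator {0..T} (fst p)"
      by (intro mult_mono) auto
    then show "(\<integral>\<^sup>+q. ennreal (cov_kernel \<kappa> p q) * indicator (wedge T) q \<partial>(lborel \<Otimes>\<^sub>M lborel)) * indicator (wedge T) p
      \<le> ennreal ((2 / \<kappa>)\<^sup>2) * (?E (snd p) (fst p) * indicator {0..T} (fst p))"
      by (simp add: mult.assoc)
  qed
  also have "\<dots> = (\<integral>\<^sup>+a. (\<integral>\<^sup>+s. ennreal ((2 / \<kappa>)\<^sup>2) * (?E s a * indicator {0..T} a) \<partial>lborel) \<partial>lborel)"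
    by (subst lborel.nn_integral_fst[symmetric]) (auto simp: case_prod_unfold)
  also have "\<dots> = ennreal ((2 / \<kappa>)\<^sup>2) * (\<integral>\<^sup>+a. (\<integral>\<^sup>+s. ?E s a \<partial>lborel) * indicator {0..T} a \<partial>lborel)"
    by (simp add: nn_integral_cmult nn_integral_multc)
  also have "\<dots> \<le> ennreal ((2 / \<kappa>)\<^sup>2) * (\<integral>\<^sup>+a. ennreal (2 / \<kappa>) * indicator {0..T} a \<partial>lborel)"
    using assms by (intro mult_left_mono nn_integral_mono mult_right_mono nn_integral_exp_abs) auto
  also have "\<dots> = ennreal ((2 / \<kappa>) ^ 3 * T)"
    using assms by (simp add: nn_integral_cmult_indicator ennreal_mult[symmetric] power2_eq_square power3_eq_cube)
  finally show ?thesis .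
qed

text \<open>Isolates from the queue what the law of large numbers uses: probabilities depending only
  on \<open>t - a\<close>, an exponentially decaying tail, and an integrable excess of pair
  probabilities over products. The pair bound is one-sided because only an upper bound on the second
  moment enters.\<close>

locale decorrelated_region = prob_space M for M :: "'a measure" +
  fixes N :: "'a \<Rightarrow> real \<times> real \<Rightarrow> bool" and g :: "real \<Rightarrow> real" and \<kappa> C c :: real
  assumes measurable_N [measurable]: "Measurable.pred (M \<Otimes>\<^sub>M (lborel \<Otimes>\<^sub>M lborel)) (\<lambda>(w, p). N w p)"
    and measurable_g [measurable]: "g \<in> borel_measurable borel"
    and prob_N: "\<And>a t. 0 \<le> a \<Longrightarrow> a \<le> t \<Longrightarrow> prob {w \<in> space M. N w (a, t)} = g (t - a)"
    and prob_N_pair: "\<And>a s b t. 0 \<le> a \<Longrightarrow> a \<le> s \<Longrightarrow> 0 \<le> b \<Longrightarrow> b \<le> t \<Longrightarrow>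
      prob {w \<in> space M. N w (a, s) \<and> N w (b, t)} \<le> g (s - a) * g (t - b) + C * cov_kernel \<kappa> (a, s) (b, t)"
    and g_nonneg: "\<And>x. 0 \<le> x \<Longrightarrow> 0 \<le> g x"
    and g_bound: "\<And>x. 0 \<le> x \<Longrightarrow> g x \<le> C * exp (- \<kappa> * x)"
    and g_integral: "(\<integral>\<^sup>+x. ennreal (g x) * indicator {0..} x \<partial>lborel) = ennreal c"
    and c_nonneg: "0 \<le> c" and \<kappa>_pos: "0 < \<kappa>" and C_nonneg: "0 \<le> C"
begin

section \<open>First two moments of the area\<close>

definition area :: "real \<Rightarrow> 'a \<Rightarrow> ennreal" where
  "area T w = (\<integral>\<^sup>+p. of_bool (N w p) * indicator (wedge T) p \<partial>(lborel \<Otimes>\<^sub>M lborel))"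

lemma measurable_N_slice [measurable]:
  "w \<in> space M \<Longrightarrow> Measurable.pred (lborel \<Otimes>\<^sub>M lborel) (N w)"
  "Measurable.pred M (\<lambda>w. N w p)"
  using measurable_compose[OF measurable_Pair1' measurable_N, of w]
    measurable_compose[OF measurable_Pair2' measurable_N, of p] by (simp_all add: space_pair_measure)

lemma measurable_area [measurable]: "area T \<in> borel_measurable M"
  unfolding area_def by measurable

lemma area_mono: "x \<le> y \<Longrightarrow> area x w \<le> area y w"
  unfolding area_def using wedge_mono[of x y]
  by (intro nn_integral_mono mult_left_mono) (auto simp: indicator_def)

lemma area_bound: "0 \<le> T \<Longrightarrow> area T w \<le> ennreal (T\<^sup>2)"
proof -
  assume T: "0 \<le> T"
  have "area T w \<le> (\<integral>\<^sup>+p. indicator ({0..T} \<times> {0..T}) p \<partial>(lborel \<Otimes>\<^sub>M lborel))"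
    unfolding area_def by (intro nn_integral_mono) (auto simp: indicator_def wedge_def)
  also have "\<dots> = emeasure (lborel \<Otimes>\<^sub>M lborel) ({0..T} \<times> {0..T})"
    by (intro nn_integral_indicator) auto
  also have "\<dots> = ennreal (T\<^sup>2)"
    using T by (subst lborel.emeasure_pair_measure_Times) (auto simp: ennreal_mult[symmetric] power2_eq_square)
  finally show ?thesis .
qed

lemma nn_integral_area:
  "(\<integral>\<^sup>+w. area T w \<partial>M) = (\<integral>\<^sup>+p. ennreal (g (snd p - fst p)) * indicator (wedge T) p \<partial>(lborel \<Otimes>\<^sub>M lborel))"
proof -
  interpret L: pair_sigma_finite M "lborel \<Otimes>\<^sub>M lborel :: (real \<times> real) measure"
    by (intro pair_sigma_finite.intro sigma_finite_measure_axioms sigma_finite_pair_measure lborel.sigma_finite_measure_axioms)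
  have "(\<integral>\<^sup>+w. area T w \<partial>M) = (\<integral>\<^sup>+p. (\<integral>\<^sup>+w. of_bool (N w p) * indicator (wedge T) p \<partial>M) \<partial>(lborel \<Otimes>\<^sub>M lborel))"
    unfolding area_def by (rule L.Fubini'[symmetric]) measurable
  also have "\<dots> = (\<integral>\<^sup>+p. ennreal (g (snd p - fst p)) * indicator (wedge T) p \<partial>(lborel \<Otimes>\<^sub>M lborel))"
  proof (rule nn_integral_cong)
    fix p :: "real \<times> real"
    obtain a t where p: "p = (a, t)" by (cases p)
    have "(\<integral>\<^sup>+w. of_bool (N w p) * indicator (wedge T) p \<partial>M) = ennreal (prob {w \<in> space M. N w p}) * indicator (wedge T) p"
      by (subst nn_integral_multc) (auto simp: nn_integral_of_bool_prob)
    also have "\<dots> = ennreal (g (snd p - fst p)) * indicator (wedge T) p"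
      by (auto simp: p indicator_def wedge_def prob_N)
    finally show "(\<integral>\<^sup>+w. of_bool (N w p) * indicator (wedge T) p \<partial>M) = ennreal (g (snd p - fst p)) * indicator (wedge T) p" .
  qed
  finally show ?thesis .
qed

lemma nn_integral_area_bounds:
  assumes "0 \<le> T"
  shows "(\<integral>\<^sup>+w. area T w \<partial>M) \<le> ennreal (c * T)"
    and "ennreal (c * T) \<le> (\<integral>\<^sup>+w. area T w \<partial>M) + ennreal (C * (4 / \<kappa>)\<^sup>2)"
proof -
  let ?g = "\<lambda>a s. ennreal (g (s - a))"
  let ?A = "\<lambda>a s. indicator (wedge T) (a, s) :: ennreal"
  \<comment> \<open>The part beyond the horizon. Together with the wedge it completes, for each
    \<open>a\<close> in \<open>{0..T}\<close>, the half line on which \<open>g\<close> integrates to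
    \<open>c\<close>, so the mean misses \<open>c * T\<close> by exactly the integral over
    \<open>?B\<close>.\<close>
  let ?B = "\<lambda>a s. indicator {0..T} a * indicator {T<..} s :: ennreal"
  have [measurable]: "(\<lambda>x. indicator (wedge T) (a, x) :: ennreal) \<in> borel_measurable borel" for a
  proof -
    have "Pair a -` wedge T \<in> sets lborel" by (rule sets_Pair1) (rule wedge_sets)
    then have "(indicator (Pair a -` wedge T) :: real \<Rightarrow> ennreal) \<in> borel_measurable borel" by simp
    then show ?thesis by (simp add: indicator_vimage comp_def)
  qed
  have area: "(\<integral>\<^sup>+w. area T w \<partial>M) = (\<integral>\<^sup>+a. (\<integral>\<^sup>+s. ?g a s * ?A a s \<partial>lborel) \<partial>lborel)"
    unfolding nn_integral_area by (subst nn_integral_wedge) auto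
  have "(\<integral>\<^sup>+a. (\<integral>\<^sup>+s. ?g a s * ?A a s \<partial>lborel) \<partial>lborel) + (\<integral>\<^sup>+a. (\<integral>\<^sup>+s. ?g a s * ?B a s \<partial>lborel) \<partial>lborel)
      = (\<integral>\<^sup>+a. (\<integral>\<^sup>+s. ?g a s * ?A a s \<partial>lborel) + (\<integral>\<^sup>+s. ?g a s * ?B a s \<partial>lborel) \<partial>lborel)"
    by (intro nn_integral_add[symmetric]) measurable
  also have "\<dots> = (\<integral>\<^sup>+a. ennreal c * indicator {0..T} a \<partial>lborel)"
  proof (rule nn_integral_cong)
    fix a :: real
    have "(\<integral>\<^sup>+s. ?g a s * ?A a s \<partial>lborel) + (\<integral>\<^sup>+s. ?g a s * ?B a s \<partial>lborel)
        = (\<integral>\<^sup>+s. ?g a s * ?A a s + ?g a s * ?B a s \<partial>lborel)"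
      by (intro nn_integral_add[symmetric]) measurable
    also have "\<dots> = (\<integral>\<^sup>+s. (?g a s * indicator {0..} (s - a)) * indicator {0..T} a \<partial>lborel)"
      by (intro nn_integral_cong) (auto simp: indicator_def wedge_def)
    also have "\<dots> = (\<integral>\<^sup>+s. ?g a s * indicator {0..} (s - a) \<partial>lborel) * indicator {0..T} a"
      by (intro nn_integral_multc) measurable
    also have "(\<integral>\<^sup>+s. ?g a s * indicator {0..} (s - a) \<partial>lborel) = ennreal c"
      using nn_integral_translate[of "\<lambda>x. ennreal (g x) * indicator {0..} x" a] g_integral by simp
    finally show "(\<integral>\<^sup>+s. ?g a s * ?A a s \<partial>lborel) + (\<integral>\<^sup>+s. ?g a s * ?B a s \<partial>lborel) = ennreal c * indicator {0..T} a" .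
  qed
  also have "\<dots> = ennreal (c * T)"
    using assms c_nonneg by (simp add: nn_integral_cmult_indicator ennreal_mult)
  finally have total: "(\<integral>\<^sup>+w. area T w \<partial>M) + (\<integral>\<^sup>+a. (\<integral>\<^sup>+s. ?g a s * ?B a s \<partial>lborel) \<partial>lborel) = ennreal (c * T)"
    by (simp add: area)
  show "(\<integral>\<^sup>+w. area T w \<partial>M) \<le> ennreal (c * T)"
    unfolding total[symmetric] by simp
  \<comment> \<open>For \<open>a \<le> T < s\<close> the length \<open>s - a\<close> splits at
    \<open>T\<close>, so \<open>g\<close> decays in both distances to \<open>T\<close> and the
    missing mass is bounded uniformly in \<open>T\<close>. Rate \<open>\<kappa> / 2\<close> per
    factor is the origin of \<open>4 / \<kappa>\<close>.\<close>
  let ?E = "\<lambda>x y. ennreal (exp (- (\<kappa> / 2) * \<bar>x - y\<bar>))"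
  have "(\<integral>\<^sup>+a. (\<integral>\<^sup>+s. ?g a s * ?B a s \<partial>lborel) \<partial>lborel) \<le> (\<integral>\<^sup>+a. (\<integral>\<^sup>+s. ennreal C * (?E a T * ?E s T) \<partial>lborel) \<partial>lborel)"
  proof (intro nn_integral_mono)
    fix a s :: real
    show "?g a s * ?B a s \<le> ennreal C * (?E a T * ?E s T)"
    proof (cases "a \<in> {0..T} \<and> s \<in> {T<..}")
      case True
      then have "g (s - a) \<le> C * exp (- \<kappa> * (s - a))" by (intro g_bound) auto
      also have "\<dots> \<le> C * (exp (- (\<kappa> / 2) * \<bar>a - T\<bar>) * exp (- (\<kappa> / 2) * \<bar>s - T\<bar>))"
      proof (intro mult_left_mono C_nonneg)
        have "exp (- \<kappa> * (s - a)) \<le> exp (- (\<kappa> / 2) * \<bar>a - T\<bar> + - (\<kappa> / 2) * \<bar>s - T\<bar>)"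
        proof -
          have "(\<kappa> / 2) * (\<bar>a - T\<bar> + \<bar>s - T\<bar>) \<le> \<kappa> * (s - a)"
            using True \<kappa>_pos by (auto simp: field_simps)
          then show ?thesis by (simp add: algebra_simps)
        qed
        then show "exp (- \<kappa> * (s - a)) \<le> exp (- (\<kappa> / 2) * \<bar>a - T\<bar>) * exp (- (\<kappa> / 2) * \<bar>s - T\<bar>)"
          by (simp only: exp_add)
      qed
      finally show ?thesis using True C_nonneg by (simp add: ennreal_mult[symmetric] ennreal_leI)
    qed (auto simp: indicator_def)
  qed
  also have "\<dots> = ennreal C * ((\<integral>\<^sup>+a. ?E a T \<partial>lborel) * (\<integral>\<^sup>+s. ?E s T \<partial>lborel))"
    by (simp add: nn_integral_cmult nn_integral_multc)
  also have "\<dots> \<le> ennreal C * (ennreal (2 / (\<kappa> / 2)) * ennreal (2 / (\<kappa> / 2)))"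
    using \<kappa>_pos by (intro mult_left_mono mult_mono nn_integral_exp_abs) auto
  also have "\<dots> = ennreal (C * (4 / \<kappa>)\<^sup>2)"
    using \<kappa>_pos C_nonneg by (simp add: ennreal_mult[symmetric] power2_eq_square)
  finally show "ennreal (c * T) \<le> (\<integral>\<^sup>+w. area T w \<partial>M) + ennreal (C * (4 / \<kappa>)\<^sup>2)"
    unfolding total[symmetric] by (intro add_left_mono)
qed

text \<open>The square of an area is an integral over pairs of points. Tonelli moves the expectation
  inside, where the pair bound separates the squared mean from a correlation term linear in
  \<open>T\<close>.\<close>

lemma nn_integral_area_square:
  assumes "0 \<le> T"
  shows "(\<integral>\<^sup>+w. area T w * area T w \<partial>M)
    \<le> (\<integral>\<^sup>+w. area T w \<partial>M) * (\<integral>\<^sup>+w. area T w \<partial>M) + ennreal (C * ((2 / \<kappa>) ^ 3 * T))"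
proof -
  let ?L = "lborel \<Otimes>\<^sub>M lborel :: (real \<times> real) measure"
  let ?I = "indicator (wedge T) :: _ \<Rightarrow> ennreal"
  let ?G = "\<lambda>p. ennreal (g (snd p - fst p))"
  interpret L: pair_sigma_finite M ?L
    by (intro pair_sigma_finite.intro sigma_finite_measure_axioms sigma_finite_pair_measure lborel.sigma_finite_measure_axioms)
  interpret LL: sigma_finite_measure ?L
    by (intro sigma_finite_pair_measure lborel.sigma_finite_measure_axioms)
  have [measurable]: "(\<lambda>(p, q). ennreal (cov_kernel \<kappa> p q)) \<in> borel_measurable (?L \<Otimes>\<^sub>M ?L)"
    unfolding cov_kernel_def by measurable
  have "(\<integral>\<^sup>+w. area T w * area T w \<partial>M)
    = (\<integral>\<^sup>+w. (\<integral>\<^sup>+p. (\<integral>\<^sup>+q. of_bool (N w p) * ?I p * (of_bool (N w q) * ?I q) \<partial>?L) \<partial>?L) \<partial>M)"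
  proof (rule nn_integral_cong)
    fix w assume [measurable]: "w \<in> space M"
    have "(\<integral>\<^sup>+p. (\<integral>\<^sup>+q. of_bool (N w p) * ?I p * (of_bool (N w q) * ?I q) \<partial>?L) \<partial>?L)
      = (\<integral>\<^sup>+p. of_bool (N w p) * ?I p * area T w \<partial>?L)"
      unfolding area_def by (intro nn_integral_cong nn_integral_cmult) measurable
    also have "\<dots> = area T w * area T w"
      unfolding area_def by (intro nn_integral_multc) measurable
    finally show "area T w * area T w = (\<integral>\<^sup>+p. (\<integral>\<^sup>+q. of_bool (N w p) * ?I p * (of_bool (N w q) * ?I q) \<partial>?L) \<partial>?L)" ..
  qed
  also have "\<dots> = (\<integral>\<^sup>+p. (\<integral>\<^sup>+w. (\<integral>\<^sup>+q. of_bool (N w p) * ?I p * (of_bool (N w q) * ?I q) \<partial>?L) \<partial>M) \<partial>?L)"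
    by (rule L.Fubini'[symmetric]) measurable
  also have "\<dots> = (\<integral>\<^sup>+p. (\<integral>\<^sup>+q. (\<integral>\<^sup>+w. of_bool (N w p) * ?I p * (of_bool (N w q) * ?I q) \<partial>M) \<partial>?L) \<partial>?L)"
    by (intro nn_integral_cong L.Fubini'[symmetric]) measurable
  also have "\<dots> \<le> (\<integral>\<^sup>+p. (\<integral>\<^sup>+q. ?G p * ?I p * (?G q * ?I q) + ennreal C * (ennreal (cov_kernel \<kappa> p q) * ?I q * ?I p) \<partial>?L) \<partial>?L)"
  proof (intro nn_integral_mono)
    fix p q :: "real \<times> real"
    obtain a s b t where pq: "p = (a, s)" "q = (b, t)" by (cases p, cases q)
    show "(\<integral>\<^sup>+w. of_bool (N w p) * ?I p * (of_bool (N w q) * ?I q) \<partial>M)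
      \<le> ?G p * ?I p * (?G q * ?I q) + ennreal C * (ennreal (cov_kernel \<kappa> p q) * ?I q * ?I p)"
    proof (cases "p \<in> wedge T \<and> q \<in> wedge T")
      case True
      then have pos: "0 \<le> a" "a \<le> s" "0 \<le> b" "b \<le> t" by (auto simp: pq wedge_def)
      have "(\<integral>\<^sup>+w. of_bool (N w p) * ?I p * (of_bool (N w q) * ?I q) \<partial>M) = (\<integral>\<^sup>+w. of_bool (N w p \<and> N w q) \<partial>M)"
        using True by (intro nn_integral_cong) auto
      also have "\<dots> = ennreal (prob {w \<in> space M. N w p \<and> N w q})"
        by (intro nn_integral_of_bool_prob) measurable
      also have "\<dots> \<le> ennreal (g (s - a) * g (t - b) + C * cov_kernel \<kappa> (a, s) (b, t))"
        unfolding pq by (intro ennreal_leI prob_N_pair pos)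
      also have "\<dots> = ennreal (g (s - a) * g (t - b)) + ennreal (C * cov_kernel \<kappa> (a, s) (b, t))"
        using pos C_nonneg by (intro ennreal_plus) (auto simp: cov_kernel_def g_nonneg)
      also have "\<dots> = ?G p * ?I p * (?G q * ?I q) + ennreal C * (ennreal (cov_kernel \<kappa> p q) * ?I q * ?I p)"
        using True pos C_nonneg by (simp add: pq ennreal_mult g_nonneg cov_kernel_def)
      finally show ?thesis .
    qed auto
  qed
  also have "\<dots> = (\<integral>\<^sup>+p. (\<integral>\<^sup>+q. ?G p * ?I p * (?G q * ?I q) \<partial>?L) + (\<integral>\<^sup>+q. ennreal C * (ennreal (cov_kernel \<kappa> p q) * ?I q * ?I p) \<partial>?L) \<partial>?L)"
    by (intro nn_integral_cong nn_integral_add) measurable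
  also have "\<dots> = (\<integral>\<^sup>+p. (\<integral>\<^sup>+q. ?G p * ?I p * (?G q * ?I q) \<partial>?L) \<partial>?L) + (\<integral>\<^sup>+p. (\<integral>\<^sup>+q. ennreal C * (ennreal (cov_kernel \<kappa> p q) * ?I q * ?I p) \<partial>?L) \<partial>?L)"
    by (intro nn_integral_add) measurable
  also have "(\<integral>\<^sup>+p. (\<integral>\<^sup>+q. ?G p * ?I p * (?G q * ?I q) \<partial>?L) \<partial>?L) = (\<integral>\<^sup>+p. ?G p * ?I p * (\<integral>\<^sup>+q. ?G q * ?I q \<partial>?L) \<partial>?L)"
    by (intro nn_integral_cong nn_integral_cmult) measurable
  also have "\<dots> = (\<integral>\<^sup>+w. area T w \<partial>M) * (\<integral>\<^sup>+w. area T w \<partial>M)"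
    unfolding nn_integral_area by (intro nn_integral_multc) measurable
  also have "(\<integral>\<^sup>+p. (\<integral>\<^sup>+q. ennreal C * (ennreal (cov_kernel \<kappa> p q) * ?I q * ?I p) \<partial>?L) \<partial>?L)
    = (\<integral>\<^sup>+p. ennreal C * ((\<integral>\<^sup>+q. ennreal (cov_kernel \<kappa> p q) * ?I q \<partial>?L) * ?I p) \<partial>?L)"
    by (intro nn_integral_cong) (simp add: nn_integral_cmult nn_integral_multc)
  also have "\<dots> = ennreal C * (\<integral>\<^sup>+p. (\<integral>\<^sup>+q. ennreal (cov_kernel \<kappa> p q) * ?I q \<partial>?L) * ?I p \<partial>?L)"
    by (intro nn_integral_cmult) measurable
  also have "\<dots> \<le> ennreal C * ennreal ((2 / \<kappa>) ^ 3 * T)"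
    by (intro mult_left_mono nn_integral_cov_kernel \<kappa>_pos assms) auto
  also have "\<dots> = ennreal (C * ((2 / \<kappa>) ^ 3 * T))"
    using C_nonneg \<kappa>_pos assms by (intro ennreal_mult[symmetric]) auto
  finally show ?thesis by (simp add: add_left_mono)
qed

lemma AE_area_average: "AE w in M. ((\<lambda>T. enn2real (area T w) / T) \<longlongrightarrow> c) at_top"
proof (rule AE_average_tendsto)
  \<comment> \<open>\<open>V * T\<close> bounds the variance and \<open>D\<close> the distance of
    the mean from \<open>c * T\<close>. The second moment about \<open>c * T\<close> is at most the
    sum of \<open>V * T\<close> and \<open>D\<^sup>2\<close>, and \<open>1 \<le> T\<close> absorbs
    the latter into the linear bound.\<close>
  define V where "V = C * (2 / \<kappa>) ^ 3"
  define D where "D = C * (4 / \<kappa>)\<^sup>2"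
  have V: "0 \<le> V" and D: "0 \<le> D" using C_nonneg \<kappa>_pos by (auto simp: V_def D_def)
  show "0 \<le> D\<^sup>2 + V" using V by simp
  show "(\<lambda>w. enn2real (area T w)) \<in> borel_measurable M" for T by measurable
  have fin: "area T w < \<infinity>" if "0 \<le> T" for T w
    using area_bound[OF that, of w] by (simp add: le_less_trans)
  show "enn2real (area x w) \<le> enn2real (area y w)" if "0 \<le> x" "x \<le> y" for w x y
    using that fin[of y w] by (intro enn2real_mono area_mono) auto
  fix T :: real assume T: "1 \<le> T"
  then have T0: "0 \<le> T" by simp
  \<comment> \<open>Expanding the square involves subtraction, so the area is moved from
    \<open>ennreal\<close> to \<open>real\<close>; \<open>area_bound\<close> provides its
    finiteness.\<close>
  define A where "A w = enn2real (area T w)" for w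
  have [measurable]: "A \<in> borel_measurable M" unfolding A_def by measurable
  have A: "ennreal (A w) = area T w" for w
    unfolding A_def using fin[OF T0, of w] by (simp add: ennreal_enn2real)
  have A0: "0 \<le> A w" for w by (simp add: A_def)
  have AT: "A w \<le> T\<^sup>2" for w
    using area_bound[OF T0, of w] A0 unfolding A[symmetric] by (simp add: ennreal_le_iff)
  have int: "integrable M A"
    using A0 AT by (intro integrable_const_bound[where B = "T\<^sup>2"]) auto
  have "A w * A w \<le> T\<^sup>2 * T\<^sup>2" for w
    using A0 AT by (intro mult_mono) auto
  then have int2: "integrable M (\<lambda>w. A w * A w)"
    using A0 by (intro integrable_const_bound[where B = "T\<^sup>2 * T\<^sup>2"]) auto
  have E: "(\<integral>\<^sup>+w. area T w \<partial>M) = ennreal (expectation A)"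
    unfolding A[symmetric] using A0 by (intro nn_integral_eq_integral int) auto
  have E2: "(\<integral>\<^sup>+w. area T w * area T w \<partial>M) = ennreal (expectation (\<lambda>w. A w * A w))"
    unfolding A[symmetric] using A0 int2
    by (subst nn_integral_eq_integral[symmetric]) (auto simp: ennreal_mult)
  have EA0: "0 \<le> expectation A" using A0 by (intro integral_nonneg_AE) auto
  have 1: "expectation A \<le> c * T" "c * T \<le> expectation A + D"
    using nn_integral_area_bounds[OF T0] EA0 D c_nonneg T0
    unfolding E D_def[symmetric] by (simp_all add: ennreal_plus[symmetric] del: ennreal_plus)
  have 2: "expectation (\<lambda>w. A w * A w) \<le> expectation A * expectation A + V * T"
  proof -
    have VT: "C * ((2 / \<kappa>) ^ 3 * T) = V * T" by (simp add: V_def)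
    have "0 \<le> V * T" using V T0 by simp
    then show ?thesis
      using nn_integral_area_square[OF T0] EA0
      unfolding E E2 VT by (simp add: ennreal_mult[symmetric] ennreal_plus[symmetric] del: ennreal_plus)
  qed
  have "(\<integral>\<^sup>+w. ennreal ((A w - c * T)\<^sup>2) \<partial>M) = ennreal (expectation (\<lambda>w. (A w - c * T)\<^sup>2))"
  proof (rule nn_integral_eq_integral)
    show "integrable M (\<lambda>w. (A w - c * T)\<^sup>2)"
      using int int2 by (simp add: power2_eq_square algebra_simps)
  qed simp
  also have "expectation (\<lambda>w. (A w - c * T)\<^sup>2) = expectation (\<lambda>w. A w * A w - (2 * c * T) * A w + (c * T)\<^sup>2)"
    by (intro Bochner_Integration.integral_cong) (auto simp: power2_eq_square algebra_simps)
  also have "\<dots> = expectation (\<lambda>w. A w * A w) - (2 * c * T) * expectation A + (c * T)\<^sup>2"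
    using int int2 by (simp add: prob_space)
  also have "ennreal \<dots> \<le> ennreal ((D\<^sup>2 + V) * T)"
  proof (rule ennreal_leI)
    have "expectation (\<lambda>w. A w * A w) - (2 * c * T) * expectation A + (c * T)\<^sup>2
      \<le> (c * T - expectation A)\<^sup>2 + V * T"
      using 2 by (simp add: power2_eq_square algebra_simps)
    also have "(c * T - expectation A)\<^sup>2 \<le> D\<^sup>2"
      using 1 by (intro power_mono) auto
    also have "D\<^sup>2 \<le> D\<^sup>2 * T"
      using T by (simp add: mult_le_cancel_left1)
    finally show "expectation (\<lambda>w. A w * A w) - (2 * c * T) * expectation A + (c * T)\<^sup>2 \<le> (D\<^sup>2 + V) * T"
      by (simp add: algebra_simps)
  qed
  finally show "(\<integral>\<^sup>+w. ennreal ((enn2real (area T w) - c * T)\<^sup>2) \<partial>M) \<le> ennreal ((D\<^sup>2 + V) * T)"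
    by (simp add: A_def)
qed simp

end

section \<open>The age as an area\<close>

lemma latest_gen_eq:
  "latest_gen n (\<lambda>j k. fst (Z j k)) (\<lambda>j k. snd (Z j k)) t
    = Sup (insert 0 {gen_time (Z j) k | j k. j < n \<and> snd (Z j k) < fst (Z j (Suc k)) \<and> gen_time (Z j) k + snd (Z j k) \<le> t})"
  unfolding latest_gen_def arr_def delivered_def gen_time_def by (simp add: conj_assoc)

text \<open>The event holds for every \<open>a\<close> above the supremum \<open>u\<close> of the
  relevant generation times and fails below it. At \<open>a = u\<close> the answer depends on
  whether the supremum is attained, but a single point has measure zero. The 0 inserted under
  \<open>Sup\<close> matches the restriction to \<open>{0..t}\<close>.\<close>

lemma age_eq_nn_integral:
  assumes Z: "\<And>j. j < n \<Longrightarrow> nonneg_seq (Z j)" and t: "0 \<le> t"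
  shows "ennreal (age n (\<lambda>j k. fst (Z j k)) (\<lambda>j k. snd (Z j k)) t)
      = (\<integral>\<^sup>+a. of_bool (\<forall>j<n. quiet (Z j) a t) * indicator {0..t} a \<partial>lborel)"
    and "0 \<le> age n (\<lambda>j k. fst (Z j k)) (\<lambda>j k. snd (Z j k)) t"
    and "age n (\<lambda>j k. fst (Z j k)) (\<lambda>j k. snd (Z j k)) t \<le> t"
proof -
  define Y where "Y = {gen_time (Z j) k | j k. j < n \<and> snd (Z j k) < fst (Z j (Suc k)) \<and> gen_time (Z j) k + snd (Z j k) \<le> t}"
  define u where "u = Sup (insert 0 Y)"
  have age: "age n (\<lambda>j k. fst (Z j k)) (\<lambda>j k. snd (Z j k)) t = t - u"
    unfolding age_def latest_gen_eq u_def Y_def ..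
  have le: "y \<le> t" if y: "y \<in> Y" for y
  proof -
    obtain j k where "y = gen_time (Z j) k" "j < n" "gen_time (Z j) k + snd (Z j k) \<le> t"
      using y unfolding Y_def by blast
    moreover have "0 \<le> snd (Z j k)" using Z[OF \<open>j < n\<close>] by (simp add: nonneg_seq_def)
    ultimately show ?thesis by linarith
  qed
  then have bdd: "bdd_above (insert 0 Y)" by (auto intro: bdd_aboveI[of _ t])
  have u0: "0 \<le> u" unfolding u_def by (rule cSup_upper[OF _ bdd]) simp
  have ut: "u \<le> t" unfolding u_def using le t by (intro cSup_least) auto
  have quiet: "(\<forall>j<n. quiet (Z j) a t) \<longleftrightarrow> (\<forall>y\<in>Y. y < a)" for a
    unfolding quiet_def Y_def by auto
  have upper: "y \<le> u" if "y \<in> Y" for y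
    unfolding u_def by (rule cSup_upper[OF _ bdd]) (use that in simp)
  have least: "u \<le> a" if "\<forall>y\<in>Y. y < a" "0 \<le> a" for a
    unfolding u_def
  proof (rule cSup_least)
    fix y assume "y \<in> insert 0 Y"
    then show "y \<le> a" using that by (auto intro: less_imp_le)
  qed simp
  have "(\<integral>\<^sup>+a. of_bool (\<forall>j<n. quiet (Z j) a t) * indicator {0..t} a \<partial>lborel) = (\<integral>\<^sup>+a. indicator {u..t} a \<partial>lborel)"
  proof (rule nn_integral_cong_AE)
    show "AE a in lborel. (of_bool (\<forall>j<n. quiet (Z j) a t) * indicator {0..t} a :: ennreal) = indicator {u..t} a"
      using AE_lborel_singleton[of u]
    proof eventually_elim
      case (elim a)
      show ?case
      proof (cases "a < u")
        case True
        then show ?thesis unfolding quiet using least[of a] by (auto simp: indicator_def)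
      next
        case False
        with elim have "u < a" by simp
        then have "\<forall>y\<in>Y. y < a" using upper by fastforce
        then show ?thesis unfolding quiet using \<open>u < a\<close> u0 by (auto simp: indicator_def)
      qed
    qed
  qed
  also have "\<dots> = ennreal (t - u)" using ut by simp
  finally show "ennreal (age n (\<lambda>j k. fst (Z j k)) (\<lambda>j k. snd (Z j k)) t)
      = (\<integral>\<^sup>+a. of_bool (\<forall>j<n. quiet (Z j) a t) * indicator {0..t} a \<partial>lborel)"
    by (simp add: age)
  show "0 \<le> age n (\<lambda>j k. fst (Z j k)) (\<lambda>j k. snd (Z j k)) t"
    "age n (\<lambda>j k. fst (Z j k)) (\<lambda>j k. snd (Z j k)) t \<le> t"
    using u0 ut by (simp_all add: age)
qed

lemma measurable_quiet_region [measurable]: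
  fixes n :: nat
  shows "(\<lambda>p. of_bool (\<forall>j<n. quiet (Z j) (fst p) (snd p)) :: ennreal) \<in> borel_measurable (lborel \<Otimes>\<^sub>M lborel)"
proof -
  have [measurable]: "Measurable.pred (lborel \<Otimes>\<^sub>M lborel) (\<lambda>p. quiet (Z j) (fst p) (snd p))" for j
    unfolding quiet_def by measurable
  have "Measurable.pred (lborel \<Otimes>\<^sub>M lborel) (\<lambda>p. \<forall>j\<in>{..<n}. quiet (Z j) (fst p) (snd p))"
    by (intro pred_intros_finite(3)) auto
  then show ?thesis unfolding of_bool_def by simp
qed

lemma integral_age:
  assumes Z: "\<And>j. j < n \<Longrightarrow> nonneg_seq (Z j)"
  shows "integral {0..T} (age n (\<lambda>j k. fst (Z j k)) (\<lambda>j k. snd (Z j k)))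
    = enn2real (\<integral>\<^sup>+p. of_bool (\<forall>j<n. quiet (Z j) (fst p) (snd p)) * indicator (wedge T) p \<partial>(lborel \<Otimes>\<^sub>M lborel))"
proof -
  let ?age = "age n (\<lambda>j k. fst (Z j k)) (\<lambda>j k. snd (Z j k))"
  define f :: "real \<times> real \<Rightarrow> ennreal" where
    "f p = of_bool (\<forall>j<n. quiet (Z j) (fst p) (snd p)) * indicator (wedge T) p" for p
  have f [measurable]: "f \<in> borel_measurable (lborel \<Otimes>\<^sub>M lborel)"
    unfolding f_def
    by (intro borel_measurable_times_ennreal measurable_quiet_region borel_measurable_indicator wedge_sets)
  let ?h = "\<lambda>t. \<integral>\<^sup>+a. f (a, t) \<partial>lborel"
  have h: "?h \<in> borel_measurable lborel" by measurable
  have h_eq: "?h t = ennreal (?age t * indicator {0..T} t)" for t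
  proof (cases "t \<in> {0..T}")
    case True
    then have "?h t = (\<integral>\<^sup>+a. of_bool (\<forall>j<n. quiet (Z j) a t) * indicator {0..t} a \<partial>lborel)"
      unfolding f_def by (intro nn_integral_cong) (simp add: wedge_def indicator_def)
    also have "\<dots> = ennreal (?age t)"
      using True by (intro age_eq_nn_integral(1)[OF Z, symmetric]) auto
    finally show ?thesis using True by simp
  next
    case False
    then have "?h t = (\<integral>\<^sup>+(a::real). 0 \<partial>lborel)"
      unfolding f_def by (intro nn_integral_cong) (auto simp: wedge_def indicator_def)
    then show ?thesis using False by simp
  qed
  have age_bounds: "0 \<le> ?age t" "?age t \<le> t" if "0 \<le> t" for t
    using age_eq_nn_integral(2,3)[OF Z that] by auto
  have nonneg: "0 \<le> ?age t * indicator {0..T} t" for t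
    using age_bounds[of t] by (auto simp: indicator_def)
  \<comment> \<open>Measurability of the age in \<open>t\<close> is read off from Tonelli, as the
    age is a section integral of a measurable function on the plane.\<close>
  have meas [measurable]: "(\<lambda>t. ?age t * indicator {0..T} t) \<in> borel_measurable lborel"
  proof -
    have "(\<lambda>t. enn2real (?h t)) \<in> borel_measurable lborel"
      by (rule measurable_compose[OF h]) measurable
    then show ?thesis unfolding h_eq using nonneg by simp
  qed
  have "integrable lborel (\<lambda>t. ?age t * indicator {0..T} t)"
  proof (rule Bochner_Integration.integrable_bound)
    show "integrable lborel (\<lambda>t. T * indicator {0..T} t)"
      by (intro integrable_mult_right integrable_real_indicator) (auto simp: emeasure_lborel_Icc_eq)
    show "AE t in lborel. norm (?age t * indicator {0..T} t) \<le> norm (T * indicator {0..T} t)"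
    proof (rule AE_I2)
      fix t
      show "norm (?age t * indicator {0..T} t) \<le> norm (T * indicator {0..T} t)"
        using age_bounds[of t] by (auto simp: indicator_def)
    qed
  qed simp
  then have int: "set_integrable lborel {0..T} ?age"
    by (simp add: set_integrable_def mult.commute)
  \<comment> \<open>The gauge integral of the statement agrees with the Lebesgue integral because
    the age is measurable and bounded by \<open>T\<close> on \<open>{0..T}\<close>.\<close>
  have "integral {0..T} ?age = (\<integral>t. ?age t * indicator {0..T} t \<partial>lborel)"
    using set_borel_integral_eq_integral(2)[OF int] by (simp add: set_lebesgue_integral_def mult.commute)
  also have "\<dots> = enn2real (\<integral>\<^sup>+t. ennreal (?age t * indicator {0..T} t) \<partial>lborel)"
    using nonneg by (intro integral_eq_nn_integral) auto
  also have "(\<integral>\<^sup>+t. ennreal (?age t * indicator {0..T} t) \<partial>lborel) = (\<integral>\<^sup>+t. ?h t \<partial>lborel)"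
    by (simp only: h_eq)
  also have "\<dots> = (\<integral>\<^sup>+p. f p \<partial>(lborel \<Otimes>\<^sub>M lborel))"
    by (rule lborel_pair.nn_integral_snd) (rule f)
  finally show ?thesis by (simp only: f_def)
qed

section \<open>Tails and their product integral\<close>

text \<open>The integral of \<open>exp (d * x)\<close> over \<open>[0, s]\<close>; with the value at
  \<open>d = 0\<close> included, equal arrival and service rates are treated uniformly.\<close>

definition exp_primitive :: "real \<Rightarrow> real \<Rightarrow> real" where
  "exp_primitive d s = (if d = 0 then s else (exp (d * s) - 1) / d)"

lemma DERIV_exp_primitive: "(exp_primitive d has_real_derivative exp (d * s)) (at s)"
  unfolding exp_primitive_def by (cases "d = 0") (auto intro!: derivative_eq_intros)

text \<open>The integral of a monotone function over \<open>[0, s]\<close> is at most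
  \<open>s\<close> times its larger endpoint value; either sign of \<open>d\<close> reduces to
  \<open>1 + y \<le> exp y\<close>.\<close>

lemma exp_primitive_bound:
  assumes "0 \<le> s"
  shows "exp_primitive d s \<le> s * max 1 (exp (d * s))"
proof -
  consider "d = 0" | "d > 0" | "d < 0" by linarith
  then show ?thesis
  proof cases
    case 1 then show ?thesis by (simp add: exp_primitive_def)
  next
    case 2
    have "1 + - (d * s) \<le> exp (- (d * s))" by (rule exp_ge_add_one_self)
    then have "(1 + - (d * s)) * exp (d * s) \<le> exp (- (d * s)) * exp (d * s)"
      by (intro mult_right_mono) auto
    then have "exp (d * s) - 1 \<le> d * (s * exp (d * s))"
      by (simp add: exp_minus algebra_simps)
    then have "exp_primitive d s \<le> s * exp (d * s)"
      using 2 by (simp add: exp_primitive_def field_simps)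
    also have "\<dots> \<le> s * max 1 (exp (d * s))"
      using assms by (intro mult_left_mono) auto
    finally show ?thesis .
  next
    case 3
    have "1 + d * s \<le> exp (d * s)" by (rule exp_ge_add_one_self)
    then have "exp_primitive d s \<le> s"
      using 3 by (simp add: exp_primitive_def field_simps)
    also have "\<dots> \<le> s * max 1 (exp (d * s))"
      using assms mult_left_mono[of 1 "max 1 (exp (d * s))" s] by simp
    finally show ?thesis .
  qed
qed

definition server_tail :: "real \<Rightarrow> real \<Rightarrow> real \<Rightarrow> real" where
  "server_tail l m s = exp (- l * s) + l * exp (- m * s) * exp_primitive (m - l) s"

lemma server_tail_0 [simp]: "server_tail l m 0 = 1"
  by (simp add: server_tail_def exp_primitive_def)

text \<open>For positive rates and \<open>0 \<le> s\<close>, the sum of the two exponentials ends at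
  rate \<open>m\<close> during its second phase, which has probability
  \<open>server_tail l m s - exp (- l * s)\<close>.\<close>

lemma DERIV_server_tail:
  "(server_tail l m has_real_derivative m * exp (- l * s) - m * server_tail l m s) (at s)"
proof -
  have "exp (- m * s) * exp ((m - l) * s) = exp (- l * s)"
    by (simp add: exp_add[symmetric] algebra_simps)
  then show ?thesis
    unfolding server_tail_def [abs_def]
    by (auto intro!: derivative_eq_intros DERIV_exp_primitive simp: algebra_simps)
qed

lemma continuous_server_tail: "continuous_on UNIV (server_tail l m)"
  by (intro continuous_at_imp_continuous_on ballI DERIV_isCont[OF DERIV_server_tail])

lemma measurable_server_tail [measurable]: "server_tail l m \<in> borel_measurable borel"
  by (intro borel_measurable_continuous_onI continuous_server_tail)

text \<open>For \<open>l = m\<close> the tail contains the factor \<open>s * exp (- l * s)\<close>.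
  Giving up half of the smaller rate absorbs the linear factor through
  \<open>k * s \<le> exp (k * s)\<close>, with a constant valid for all pairs of rates.\<close>

lemma server_tail_bound:
  assumes "0 < l" "0 < m" "0 \<le> s"
  shows "server_tail l m s \<le> (1 + 2 * l / min l m) * exp (- (min l m / 2) * s)"
proof -
  define k where "k = min l m / 2"
  have k: "0 < k" "2 * k \<le> l" "2 * k \<le> m" using assms by (auto simp: k_def)
  have l: "exp (- l * s) \<le> exp (- k * s) * exp (- k * s)"
    using k assms mult_right_mono[of "2 * k" l s] by (simp add: exp_add[symmetric])
  have m: "exp (- m * s) \<le> exp (- k * s) * exp (- k * s)"
    using k assms mult_right_mono[of "2 * k" m s] by (simp add: exp_add[symmetric])
  have ks: "s * exp (- k * s) \<le> 1 / k"
  proof -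
    have "k * s \<le> exp (k * s)" using exp_ge_add_one_self[of "k * s"] by linarith
    then have "k * s * exp (- k * s) \<le> exp (k * s) * exp (- k * s)" by (intro mult_right_mono) auto
    then show ?thesis using k by (simp add: exp_minus field_simps)
  qed
  have "exp (- m * s) * exp_primitive (m - l) s \<le> exp (- m * s) * (s * max 1 (exp ((m - l) * s)))"
    using assms by (intro mult_left_mono exp_primitive_bound) auto
  also have "\<dots> = s * max (exp (- m * s)) (exp (- l * s))"
  proof -
    have "exp (- m * s) * max 1 (exp ((m - l) * s)) = max (exp (- m * s) * 1) (exp (- m * s) * exp ((m - l) * s))"
      by (subst max_mult_distrib_left) auto
    also have "\<dots> = max (exp (- m * s)) (exp (- l * s))"
      by (simp add: exp_add[symmetric] algebra_simps)
    finally show ?thesis by (simp add: mult.left_commute)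
  qed
  also have "\<dots> \<le> s * (exp (- k * s) * exp (- k * s))"
    using l m assms by (intro mult_left_mono) auto
  also have "\<dots> = (s * exp (- k * s)) * exp (- k * s)" by simp
  also have "\<dots> \<le> 1 / k * exp (- k * s)"
    by (intro mult_right_mono ks) auto
  finally have "l * (exp (- m * s) * exp_primitive (m - l) s) \<le> l * (1 / k * exp (- k * s))"
    using assms by (intro mult_left_mono) auto
  moreover have "exp (- l * s) \<le> exp (- k * s)"
    using k assms mult_right_mono[of k l s] by simp
  ultimately have "exp (- l * s) + l * (exp (- m * s) * exp_primitive (m - l) s)
      \<le> exp (- k * s) + l * (1 / k * exp (- k * s))"
    by (intro add_mono)
  then have "server_tail l m s \<le> (1 + l / k) * exp (- k * s)"
    by (simp add: server_tail_def distrib_right mult.assoc)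
  then show ?thesis by (simp add: k_def mult.commute)
qed

lemma integral_server_tail_product:
  fixes l\<^sub>0 l\<^sub>1 m\<^sub>0 m\<^sub>1 :: real
  assumes pos: "0 < l\<^sub>0" "0 < l\<^sub>1" "0 < m\<^sub>0" "0 < m\<^sub>1"
    and nonneg: "\<And>s. 0 \<le> s \<Longrightarrow> 0 \<le> server_tail l\<^sub>0 m\<^sub>0 s" "\<And>s. 0 \<le> s \<Longrightarrow> 0 \<le> server_tail l\<^sub>1 m\<^sub>1 s"
  shows "(\<integral>\<^sup>+s. ennreal (server_tail l\<^sub>0 m\<^sub>0 s * server_tail l\<^sub>1 m\<^sub>1 s) * indicator {0..} s \<partial>lborel)
    = ennreal (1 / (m\<^sub>0 + m\<^sub>1) + 1 / (l\<^sub>0 + l\<^sub>1)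
        + 1 / ((m\<^sub>0 + m\<^sub>1) * (l\<^sub>0 + l\<^sub>1)) * (m\<^sub>0 * l\<^sub>1 / (l\<^sub>0 + m\<^sub>1) + m\<^sub>1 * l\<^sub>0 / (l\<^sub>1 + m\<^sub>0)))"
proof -
  let ?G0 = "server_tail l\<^sub>0 m\<^sub>0" and ?G1 = "server_tail l\<^sub>1 m\<^sub>1"
  \<comment> \<open>The primitive comes from the linear ODE \<open>G' = m * exp (- l * s) - m * G\<close> of each tail: applied to
    \<open>G\<^sub>0 * G\<^sub>1\<close> and then to \<open>exp (- l\<^sub>0 * s) * G\<^sub>1\<close> and \<open>exp (- l\<^sub>1 * s) * G\<^sub>0\<close> it closes up.\<close>
  define F where "F s = - (?G0 s * ?G1 s
      + m\<^sub>0 / (l\<^sub>0 + m\<^sub>1) * (exp (- l\<^sub>0 * s) * ?G1 s + m\<^sub>1 / (l\<^sub>0 + l\<^sub>1) * exp (- (l\<^sub>0 + l\<^sub>1) * s))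
      + m\<^sub>1 / (l\<^sub>1 + m\<^sub>0) * (exp (- l\<^sub>1 * s) * ?G0 s + m\<^sub>0 / (l\<^sub>0 + l\<^sub>1) * exp (- (l\<^sub>0 + l\<^sub>1) * s))) / (m\<^sub>0 + m\<^sub>1)" for s
  have E: "exp (- (l\<^sub>0 + l\<^sub>1) * s) = exp (- l\<^sub>0 * s) * exp (- l\<^sub>1 * s)" for s
    by (simp add: exp_add[symmetric] algebra_simps)
  have deriv: "DERIV F s :> ?G0 s * ?G1 s" for s
  proof -
    have p: "l\<^sub>0 + m\<^sub>1 \<noteq> 0" "l\<^sub>1 + m\<^sub>0 \<noteq> 0" "l\<^sub>0 + l\<^sub>1 \<noteq> 0" "m\<^sub>0 + m\<^sub>1 \<noteq> 0" using pos by auto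
    define a b G H where "a = exp (- l\<^sub>0 * s)" and "b = exp (- l\<^sub>1 * s)" and "G = ?G0 s" and "H = ?G1 s"
    have E01: "DERIV (\<lambda>s. exp (- (l\<^sub>0 + l\<^sub>1) * s)) s :> - (l\<^sub>0 + l\<^sub>1) * (a * b)"
      unfolding a_def b_def E[symmetric] by (auto intro!: derivative_eq_intros)
    have E0: "DERIV (\<lambda>s. exp (- l\<^sub>0 * s)) s :> - l\<^sub>0 * a"
      unfolding a_def by (auto intro!: derivative_eq_intros)
    have E1: "DERIV (\<lambda>s. exp (- l\<^sub>1 * s)) s :> - l\<^sub>1 * b"
      unfolding b_def by (auto intro!: derivative_eq_intros)
    have D0: "DERIV ?G0 s :> m\<^sub>0 * a - m\<^sub>0 * G" unfolding a_def G_def by (rule DERIV_server_tail)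
    have D1: "DERIV ?G1 s :> m\<^sub>1 * b - m\<^sub>1 * H" unfolding b_def H_def by (rule DERIV_server_tail)
    \<comment> \<open>The derivative of \<open>a * H\<close> is
      \<open>m\<^sub>1 * a * b - (l\<^sub>0 + m\<^sub>1) * a * H\<close>. The extra exponential in
      \<open>F\<close> removes the \<open>a * b\<close> part, and the prefactor turns the rest into
      \<open>- m\<^sub>0 * a * H\<close>, which cancels the source term in the derivative of
      \<open>G * H\<close>; \<open>t2\<close> is symmetric.\<close>
    have t1: "m\<^sub>0 / (l\<^sub>0 + m\<^sub>1) * ((- l\<^sub>0 * a * H + (m\<^sub>1 * b - m\<^sub>1 * H) * a) + m\<^sub>1 / (l\<^sub>0 + l\<^sub>1) * (- (l\<^sub>0 + l\<^sub>1) * (a * b))) = - m\<^sub>0 * a * H"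
      using p by (simp add: field_simps)
    have t2: "m\<^sub>1 / (l\<^sub>1 + m\<^sub>0) * ((- l\<^sub>1 * b * G + (m\<^sub>0 * a - m\<^sub>0 * G) * b) + m\<^sub>0 / (l\<^sub>0 + l\<^sub>1) * (- (l\<^sub>0 + l\<^sub>1) * (a * b))) = - m\<^sub>1 * b * G"
      using p by (simp add: field_simps)
    have "DERIV F s :> - (((m\<^sub>0 * a - m\<^sub>0 * G) * H + (m\<^sub>1 * b - m\<^sub>1 * H) * G)
      + m\<^sub>0 / (l\<^sub>0 + m\<^sub>1) * ((- l\<^sub>0 * a * H + (m\<^sub>1 * b - m\<^sub>1 * H) * a) + m\<^sub>1 / (l\<^sub>0 + l\<^sub>1) * (- (l\<^sub>0 + l\<^sub>1) * (a * b)))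
      + m\<^sub>1 / (l\<^sub>1 + m\<^sub>0) * ((- l\<^sub>1 * b * G + (m\<^sub>0 * a - m\<^sub>0 * G) * b) + m\<^sub>0 / (l\<^sub>0 + l\<^sub>1) * (- (l\<^sub>0 + l\<^sub>1) * (a * b)))) / (m\<^sub>0 + m\<^sub>1)"
      unfolding F_def[abs_def]
      by (intro DERIV_cdivide DERIV_minus DERIV_add DERIV_cmult E01
          DERIV_mult[OF D0 D1, folded G_def H_def] DERIV_mult[OF E0 D1, folded a_def H_def]
          DERIV_mult[OF E1 D0, folded b_def G_def])
    also have "- (((m\<^sub>0 * a - m\<^sub>0 * G) * H + (m\<^sub>1 * b - m\<^sub>1 * H) * G)
      + m\<^sub>0 / (l\<^sub>0 + m\<^sub>1) * ((- l\<^sub>0 * a * H + (m\<^sub>1 * b - m\<^sub>1 * H) * a) + m\<^sub>1 / (l\<^sub>0 + l\<^sub>1) * (- (l\<^sub>0 + l\<^sub>1) * (a * b)))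
      + m\<^sub>1 / (l\<^sub>1 + m\<^sub>0) * ((- l\<^sub>1 * b * G + (m\<^sub>0 * a - m\<^sub>0 * G) * b) + m\<^sub>0 / (l\<^sub>0 + l\<^sub>1) * (- (l\<^sub>0 + l\<^sub>1) * (a * b)))) / (m\<^sub>0 + m\<^sub>1)
      = G * H"
      unfolding t1 t2 using p by (simp add: field_simps)
    finally show ?thesis unfolding G_def H_def .
  qed
  have lim_exp: "((\<lambda>s. exp (- k * s)) \<longlongrightarrow> 0) at_top" if "0 < k" for k :: real
    using that by real_asymp
  have lim_tail: "(server_tail l m \<longlongrightarrow> 0) at_top"
    if "0 < l" "0 < m" "\<And>s. 0 \<le> s \<Longrightarrow> 0 \<le> server_tail l m s" for l m
  proof (rule tendsto_sandwich)
    show "\<forall>\<^sub>F s in at_top. 0 \<le> server_tail l m s"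
      using eventually_ge_at_top[of 0] by eventually_elim (rule that(3))
    show "\<forall>\<^sub>F s in at_top. server_tail l m s \<le> (1 + 2 * l / min l m) * exp (- (min l m / 2) * s)"
      using eventually_ge_at_top[of 0] by eventually_elim (use that in \<open>intro server_tail_bound\<close>)
    show "((\<lambda>s. (1 + 2 * l / min l m) * exp (- (min l m / 2) * s)) \<longlongrightarrow> 0) at_top"
      by (intro tendsto_mult_right_zero lim_exp) (use that in auto)
  qed auto
  have lim: "(F \<longlongrightarrow> - (0 * 0 + m\<^sub>0 / (l\<^sub>0 + m\<^sub>1) * (0 * 0 + m\<^sub>1 / (l\<^sub>0 + l\<^sub>1) * 0)
      + m\<^sub>1 / (l\<^sub>1 + m\<^sub>0) * (0 * 0 + m\<^sub>0 / (l\<^sub>0 + l\<^sub>1) * 0)) / (m\<^sub>0 + m\<^sub>1)) at_top"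
    unfolding F_def[abs_def]
    using pos nonneg by (intro tendsto_intros lim_tail lim_exp) auto
  have "(\<integral>\<^sup>+s. ennreal (?G0 s * ?G1 s) * indicator {0..} s \<partial>lborel) = 0 - F 0"
    using lim by (intro nn_integral_FTC_atLeast deriv) (auto intro!: mult_nonneg_nonneg nonneg)
  also have "0 - F 0 = 1 / (m\<^sub>0 + m\<^sub>1) + 1 / (l\<^sub>0 + l\<^sub>1)
        + 1 / ((m\<^sub>0 + m\<^sub>1) * (l\<^sub>0 + l\<^sub>1)) * (m\<^sub>0 * l\<^sub>1 / (l\<^sub>0 + m\<^sub>1) + m\<^sub>1 * l\<^sub>0 / (l\<^sub>1 + m\<^sub>0))"
  proof -
    define L M P Q where "L = l\<^sub>0 + l\<^sub>1" and "M = m\<^sub>0 + m\<^sub>1" and "P = l\<^sub>0 + m\<^sub>1" and "Q = l\<^sub>1 + m\<^sub>0"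
    have p: "L \<noteq> 0" "M \<noteq> 0" "P \<noteq> 0" "Q \<noteq> 0" using pos by (auto simp: L_def M_def P_def Q_def)
    \<comment> \<open>\<open>L + m\<^sub>1 = P + l\<^sub>1\<close> exchanges the numerators found at
      \<open>s = 0\<close> for those of the stated formula. The leftovers
      \<open>m\<^sub>0 / L\<close> and \<open>m\<^sub>1 / L\<close> add up to \<open>M / L\<close>,
      the source of the term \<open>1 / (l\<^sub>0 + l\<^sub>1)\<close>.\<close>
    have a: "m\<^sub>0 / P * (1 + m\<^sub>1 / L) = m\<^sub>0 / L + m\<^sub>0 * l\<^sub>1 / P / L"
    proof -
      have "L + m\<^sub>1 = P + l\<^sub>1" by (simp add: L_def P_def)
      then have "m\<^sub>0 / P * ((L + m\<^sub>1) / L) = m\<^sub>0 / P * ((P + l\<^sub>1) / L)" by simp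
      then show ?thesis using p by (simp add: field_simps)
    qed
    have b: "m\<^sub>1 / Q * (1 + m\<^sub>0 / L) = m\<^sub>1 / L + m\<^sub>1 * l\<^sub>0 / Q / L"
    proof -
      have "L + m\<^sub>0 = Q + l\<^sub>0" by (simp add: L_def Q_def)
      then have "m\<^sub>1 / Q * ((L + m\<^sub>0) / L) = m\<^sub>1 / Q * ((Q + l\<^sub>0) / L)" by simp
      then show ?thesis using p by (simp add: field_simps)
    qed
    define X where "X = 1 + m\<^sub>0 / P * (1 + m\<^sub>1 / L) + m\<^sub>1 / Q * (1 + m\<^sub>0 / L)"
    have "F 0 = - X / M"
      unfolding F_def X_def L_def M_def P_def Q_def by simp
    then have "0 - F 0 = X / M" by simp
    also have "\<dots> = (1 + M / L + (m\<^sub>0 * l\<^sub>1 / P + m\<^sub>1 * l\<^sub>0 / Q) / L) / M"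
      unfolding X_def a b by (simp add: M_def add_divide_distrib)
    also have "\<dots> = 1 / M + 1 / L + 1 / (M * L) * (m\<^sub>0 * l\<^sub>1 / P + m\<^sub>1 * l\<^sub>0 / Q)"
      using p by (simp add: add_divide_distrib mult_ac)
    finally show ?thesis unfolding L_def M_def P_def Q_def .
  qed
  finally show ?thesis .
qed

section \<open>The average age\<close>

lemma (in server) age_tail_eq:
  assumes "0 \<le> s"
  shows "age_tail s = server_tail l m s"
proof -
  have "(\<integral>x. (if x < s then exp (- m * (s - x)) else 0) \<partial>exp_law l)
    = (\<integral>x. exponential_density l x * (if x < s then exp (- m * (s - x)) else 0) \<partial>lborel)"
    by (intro integral_exp_law arrival_rate_pos) measurable
  also have "\<dots> = (\<integral>x. indicator {0..s} x *\<^sub>R (l * exp (- m * s) * exp ((m - l) * x)) \<partial>lborel)"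
  proof (rule integral_cong_AE)
    show "AE x in lborel. exponential_density l x * (if x < s then exp (- m * (s - x)) else 0)
      = indicator {0..s} x *\<^sub>R (l * exp (- m * s) * exp ((m - l) * x))"
      using AE_lborel_singleton[of s]
    proof eventually_elim
      case (elim x)
      have "exp (- x * l) * exp (- m * (s - x)) = exp (- m * s) * exp ((m - l) * x)"
        by (simp add: exp_add[symmetric] algebra_simps)
      then show ?case using elim
        by (auto simp: exponential_density_def indicator_def)
    qed
  qed measurable
  also have "\<dots> = l * exp (- m * s) * exp_primitive (m - l) s - l * exp (- m * s) * exp_primitive (m - l) 0"
  proof (rule integral_FTC_atLeastAtMost[OF assms])
    show "((\<lambda>x. l * exp (- m * s) * exp_primitive (m - l) x) has_vector_derivative l * exp (- m * s) * exp ((m - l) * x)) (at x within {0..s})" for x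
      unfolding has_real_derivative_iff_has_vector_derivative[symmetric]
      by (intro DERIV_cmult has_field_derivative_at_within[OF DERIV_exp_primitive])
    show "continuous_on {0..s} (\<lambda>x. l * exp (- m * s) * exp ((m - l) * x))"
      by (intro continuous_intros)
  qed
  finally show ?thesis
    by (simp add: age_tail_def server_tail_def exp_primitive_def)
qed

text \<open>The sign is inherited from the probabilistic meaning of the closed form.\<close>

lemma (in server) server_tail_nonneg:
  assumes "0 \<le> s"
  shows "0 \<le> server_tail l m s"
  using quiet_prob_bounds[of 0 s] quiet_prob_eq[of 0 s] age_tail_eq[of s] assms by simp

text \<open>For overlapping intervals all four endpoints lie within the larger of the two lengths.\<close>

lemma cov_kernel_overlap:
  assumes "0 < k" "a \<le> s" "b \<le> t" "b \<le> s" "a \<le> t"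
  shows "exp (- (3 * k) * max (s - a) (t - b)) \<le> cov_kernel k (a, s) (b, t)"
proof -
  have "k * (\<bar>s - a\<bar> + \<bar>b - a\<bar> + \<bar>t - b\<bar>) \<le> k * (3 * max (s - a) (t - b))"
    using assms by (intro mult_left_mono) (auto simp: max_def)
  then have "exp (- (3 * k) * max (s - a) (t - b)) \<le> exp (- k * \<bar>s - a\<bar> + - k * \<bar>b - a\<bar> + - k * \<bar>t - b\<bar>)"
    by (simp add: algebra_simps)
  then show ?thesis by (simp only: exp_add cov_kernel_def fst_conv snd_conv)
qed

theorem theorem5:
  fixes M :: "'a measure"
    and X S :: "nat \<Rightarrow> nat \<Rightarrow> 'a \<Rightarrow> real"
    and lam mu :: "nat \<Rightarrow> real"
  assumes "prob_space M"
    and "\<And>j. j < 2 \<Longrightarrow> lam j > 0"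
    and "\<And>j. j < 2 \<Longrightarrow> mu j > 0"
    and "\<And>j k. j < 2 \<Longrightarrow> distributed M lborel (X j k) (exponential_density (lam j))"
    and "\<And>j k. j < 2 \<Longrightarrow> distributed M lborel (S j k) (exponential_density (mu j))"
    and "prob_space.indep_vars M (\<lambda>_. borel)
           (case_sum (\<lambda>(j, k). X j k) (\<lambda>(j, k). S j k))
           (({..<2} \<times> UNIV) <+> ({..<2} \<times> UNIV))"
  shows "AE \<omega> in M.
    ((\<lambda>T. (1 / T) * integral {0..T} (age 2 (\<lambda>j k. X j k \<omega>) (\<lambda>j k. S j k \<omega>)))
      \<longlongrightarrow> 1 / (mu 0 + mu 1) + 1 / (lam 0 + lam 1)
          + 1 / ((mu 0 + mu 1) * (lam 0 + lam 1))
            * (mu 0 * lam 1 / (lam 0 + mu 1) + mu 1 * lam 0 / (lam 1 + mu 0))) at_top"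
proof -
  interpret prob_space M by fact
  have pos: "0 < lam 0" "0 < lam 1" "0 < mu 0" "0 < mu 1" using assms(2,3) by simp_all
  interpret A: server "lam 0" "mu 0" using pos by unfold_locales
  interpret B: server "lam 1" "mu 1" using pos by unfold_locales
  have [measurable]: "packets X S 0 \<in> measurable M A.law" "packets X S 1 \<in> measurable M B.law"
    using assms(4-6) pos by (auto intro!: distr_packets_law(1)[where J = "{..<2}"])
  have pair: "prob {w \<in> space M. P (packets X S 0 w) \<and> Q (packets X S 1 w)}
      = (\<integral>z. of_bool (P z) \<partial>A.law) * (\<integral>z. of_bool (Q z) \<partial>B.law)"
    if "Measurable.pred A.law P" "Measurable.pred B.law Q" for P Q
    by (rule prob_packets_pair[where J = "{..<2}"]) (use assms(4-6) pos that in auto)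
  let ?U = "packets X S"
  let ?T0 = "server_tail (lam 0) (mu 0)" and ?T1 = "server_tail (lam 1) (mu 1)"
  define N where "N w p \<longleftrightarrow> quiet (?U 0 w) (fst p) (snd p) \<and> quiet (?U 1 w) (fst p) (snd p)" for w p
  define g where "g x = ?T0 x * ?T1 x" for x
  define C where "C = (1 + 2 * lam 0 / min (lam 0) (mu 0)) * (1 + 2 * lam 1 / min (lam 1) (mu 1))"
  \<comment> \<open>A third of the decay rate of \<open>g\<close>: for overlapping intervals one
    factor of decay \<open>3 * \<kappa>\<close> has to pay for all three links of
    \<open>cov_kernel\<close>.\<close>
  define \<kappa> where "\<kappa> = (min (lam 0) (mu 0) / 2 + min (lam 1) (mu 1) / 2) / 3"
  define c where "c = 1 / (mu 0 + mu 1) + 1 / (lam 0 + lam 1)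
          + 1 / ((mu 0 + mu 1) * (lam 0 + lam 1))
            * (mu 0 * lam 1 / (lam 0 + mu 1) + mu 1 * lam 0 / (lam 1 + mu 0))"
  have C: "0 \<le> C" and \<kappa>: "0 < \<kappa>" and c: "0 \<le> c"
    using pos by (auto simp: C_def \<kappa>_def c_def intro!: add_nonneg_nonneg mult_nonneg_nonneg divide_nonneg_nonneg)
  have g0: "0 \<le> g x" if "0 \<le> x" for x
    unfolding g_def using A.server_tail_nonneg[OF that] B.server_tail_nonneg[OF that] by simp
  have g3: "g x \<le> C * exp (- (3 * \<kappa>) * x)" if "0 \<le> x" for x
  proof -
    have "g x \<le> ((1 + 2 * lam 0 / min (lam 0) (mu 0)) * exp (- (min (lam 0) (mu 0) / 2) * x))
      * ((1 + 2 * lam 1 / min (lam 1) (mu 1)) * exp (- (min (lam 1) (mu 1) / 2) * x))"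
      unfolding g_def using A.server_tail_nonneg[OF that] B.server_tail_nonneg[OF that] pos that
      by (intro mult_mono server_tail_bound) auto
    also have "\<dots> = C * (exp (- (min (lam 0) (mu 0) / 2) * x) * exp (- (min (lam 1) (mu 1) / 2) * x))"
      unfolding C_def by (simp only: mult_ac)
    also have "\<dots> = C * exp (- (3 * \<kappa>) * x)"
      unfolding \<kappa>_def exp_add[symmetric] by (simp add: algebra_simps)
    finally show ?thesis .
  qed
  have prob1: "prob {w \<in> space M. N w (a, t)} = g (t - a)" if "0 \<le> a" "a \<le> t" for a t
  proof -
    have "prob {w \<in> space M. N w (a, t)} = A.quiet_prob a t * B.quiet_prob a t"
      unfolding N_def A.quiet_prob_def B.quiet_prob_def fst_conv snd_conv by (rule pair; measurable)
    then show ?thesis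
      using that by (simp add: g_def A.quiet_prob_eq B.quiet_prob_eq A.age_tail_eq B.age_tail_eq del: One_nat_def)
  qed
  have indep: "prob {w \<in> space M. N w (a, s) \<and> N w (b, t)} = g (s - a) * g (t - b)"
    if "0 \<le> a" "a \<le> s" "s \<le> b" "b \<le> t" for a s b t
  proof -
    have "prob {w \<in> space M. N w (a, s) \<and> N w (b, t)}
      = prob {w \<in> space M. (quiet (?U 0 w) a s \<and> quiet (?U 0 w) b t) \<and> (quiet (?U 1 w) a s \<and> quiet (?U 1 w) b t)}"
      unfolding N_def by (rule arg_cong[where f = prob]) auto
    also have "\<dots> = (\<integral>z. of_bool (quiet z a s \<and> quiet z b t) \<partial>A.law) * (\<integral>z. of_bool (quiet z a s \<and> quiet z b t) \<partial>B.law)"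
      by (rule pair; measurable)
    also have "\<dots> = g (s - a) * g (t - b)"
      using that by (simp only: A.quiet_pair_prob B.quiet_pair_prob)
        (simp add: g_def A.age_tail_eq B.age_tail_eq del: One_nat_def)
    finally show ?thesis .
  qed
  interpret decorrelated_region M N g \<kappa> C c
  proof
    show measN: "Measurable.pred (M \<Otimes>\<^sub>M (lborel \<Otimes>\<^sub>M lborel)) (\<lambda>(w, p). N w p)"
      unfolding N_def by measurable
    have [measurable]: "Measurable.pred M (\<lambda>w. N w p)" for p
      unfolding N_def by measurable
    show "g \<in> borel_measurable borel" unfolding g_def by measurable
    show "prob {w \<in> space M. N w (a, t)} = g (t - a)" if "0 \<le> a" "a \<le> t" for a t
      by (rule prob1) fact+
    show "0 \<le> g x" if "0 \<le> x" for x by (rule g0) fact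
    show "g x \<le> C * exp (- \<kappa> * x)" if "0 \<le> x" for x
    proof -
      have "exp (- (3 * \<kappa>) * x) \<le> exp (- \<kappa> * x)" using \<kappa> that by simp
      with g3[OF that] C show ?thesis by (meson mult_left_mono order_trans)
    qed
    show "(\<integral>\<^sup>+x. ennreal (g x) * indicator {0..} x \<partial>lborel) = ennreal c"
      unfolding g_def c_def using pos A.server_tail_nonneg B.server_tail_nonneg
      by (intro integral_server_tail_product)
    show "prob {w \<in> space M. N w (a, s) \<and> N w (b, t)} \<le> g (s - a) * g (t - b) + C * cov_kernel \<kappa> (a, s) (b, t)"
      if *: "0 \<le> a" "a \<le> s" "0 \<le> b" "b \<le> t" for a s b t
    proof -
      have K: "0 \<le> C * cov_kernel \<kappa> (a, s) (b, t)" using C by (simp add: cov_kernel_def)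
      have gg: "0 \<le> g (s - a) * g (t - b)" using * by (intro mult_nonneg_nonneg g0) auto
      \<comment> \<open>Intervals that are disjoint up to an endpoint, in either order, give exact
        independence and leave the kernel as slack. Overlapping ones are bounded by the single event
        of the longer interval, with the product term simply added.\<close>
      consider "s \<le> b" | "t \<le> a" | "b \<le> s" "a \<le> t" by linarith
      then show ?thesis
      proof cases
        case 1
        then show ?thesis using indep[of a s b t] * K by simp
      next
        case 2
        then have "prob {w \<in> space M. N w (a, s) \<and> N w (b, t)} = g (t - b) * g (s - a)"
          using indep[of b t a s] * by (simp add: conj_commute)
        then show ?thesis using K by (simp add: mult.commute)
      next
        case 3
        have "prob {w \<in> space M. N w (a, s) \<and> N w (b, t)} \<le> prob {w \<in> space M. N w (a, s)}"
          by (intro finite_measure_mono) auto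
        also have "\<dots> \<le> C * exp (- (3 * \<kappa>) * (s - a))"
          using prob1[of a s] g3[of "s - a"] * by simp
        finally have p1: "prob {w \<in> space M. N w (a, s) \<and> N w (b, t)} \<le> C * exp (- (3 * \<kappa>) * (s - a))" .
        have "prob {w \<in> space M. N w (a, s) \<and> N w (b, t)} \<le> prob {w \<in> space M. N w (b, t)}"
          by (intro finite_measure_mono) auto
        also have "\<dots> \<le> C * exp (- (3 * \<kappa>) * (t - b))"
          using prob1[of b t] g3[of "t - b"] * by simp
        finally have p2: "prob {w \<in> space M. N w (a, s) \<and> N w (b, t)} \<le> C * exp (- (3 * \<kappa>) * (t - b))" .
        have "prob {w \<in> space M. N w (a, s) \<and> N w (b, t)} \<le> C * exp (- (3 * \<kappa>) * max (s - a) (t - b))"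
          using p1 p2 by (cases "s - a \<le> t - b") (simp_all only: max_def if_True if_False)
        also have "\<dots> \<le> C * cov_kernel \<kappa> (a, s) (b, t)"
          using * 3 \<kappa> C by (intro mult_left_mono cov_kernel_overlap) auto
        finally show ?thesis using gg by linarith
      qed
    qed
  qed (use C \<kappa> c in auto)
  have "AE w in M. nonneg_seq (?U 0 w)" "AE w in M. nonneg_seq (?U 1 w)"
    by (rule AE_packets_nonneg[where J = "{..<2}" and l = lam and m = mu]; use assms(4-6) pos in auto)+
  then show ?thesis
    using AE_area_average
  proof eventually_elim
    case (elim w)
    have "nonneg_seq (?U j w)" if "j < 2" for j
      using elim(1,2) that by (cases "j = 0") (auto simp: less_2_cases_iff)
    then have "integral {0..T} (age 2 (\<lambda>j k. fst (?U j w k)) (\<lambda>j k. snd (?U j w k)))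
      = enn2real (\<integral>\<^sup>+p. of_bool (\<forall>j<2. quiet (?U j w) (fst p) (snd p)) * indicator (wedge T) p \<partial>(lborel \<Otimes>\<^sub>M lborel))" for T
      by (rule integral_age)
    moreover have "(\<forall>j<2. quiet (?U j w) (fst p) (snd p)) \<longleftrightarrow> N w p" for p
      unfolding N_def by (auto simp: less_2_cases_iff)
    ultimately have "integral {0..T} (age 2 (\<lambda>j k. X j k w) (\<lambda>j k. S j k w)) = enn2real (area T w)" for T
      unfolding area_def by (simp add: packets_def)
    with elim(3) show ?case by (simp add: c_def)
  qed
qed

end
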